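(* Let $\mathcal{H}$ be a real Hilbert space, $t_0>0$, and let $\Phi,U:\mathcal{H}\to\mathbb{R}$ and $\varepsilon:[t_0,+\infty)\to(0,+\infty)$ satisfy the standing assumptions listed in the context. Assume that $U$ is strongly convex and that $\gamma(t)=\dfrac{\alpha}{t^{\theta}}$ for $t\ge t_0$, where $0\le\theta\le 1$, with $\alpha>0$ if $0\le\theta<1$ and $\alpha>3$ if $\theta=1$. Suppose in addition that $$\int_{t_0}^{+\infty}t^{\theta}\varepsilon(t)\,dt=+\infty.$$ Let $x\in C^2([t_0,+\infty);\mathcal{H})$ be a classical solution of $$x''(t)+\gamma(t)x'(t)+\nabla\Phi(x(t))+\varepsilon(t)\nabla U(x(t))=0,\qquad t\ge t_0.$$ Then the following two assertions hold: (Q$_1$) If $x'(t)=o(1/t^{\theta})$ as $t\to+\infty$ and $\int_{t_0}^{+\infty}t^{\theta}\|x'(t)\|^2\,dt<+\infty$, then $x(t)$ converges strongly, as $t\to+\infty$, to the unique minimizer $p^{*}$ of $U$ on $S_\Phi$. (Q$_2$) If the unique minimizer $x^{*}$ of $U$ on $\mathcal{H}$ belongs to $S_\Phi$, then $x(t)$ converges strongly to $x^{*}$ as $t\to+\infty$, and the energy function $$W(t)=\tfrac12\|x'(t)\|^2+\Phi(x(t))-\Phi^{*}+\varepsilon(t)\,(U(x(t))-U^{*})$$ satisfies $$W(t)=o\!\left(1/t^{1+\theta}\right)\ (t\to+\infty)\qquad\text{and}\qquad\int_{t_0}^{+\infty}t^{\theta}W(t)\,dt<+\infty.$$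
   Context: $\mathcal{H}$ is a real Hilbert space with inner product $\langle\cdot,\cdot\rangle$ and norm $\|\cdot\|$; $t_0>0$ is fixed. Standing assumptions: (1) $\Phi,U:\mathcal{H}\to\mathbb{R}$ are convex, continuously differentiable and bounded from below; $\Phi^{*}=\inf_{\mathcal{H}}\Phi$, $U^{*}=\inf_{\mathcal{H}}U$. (2) The set $S_\Phi=\operatorname{argmin}\Phi=\{z\in\mathcal{H}:\Phi(z)=\Phi^{*}\}$ is nonempty. (3) The gradients $\nabla\Phi$ and $\nabla U$ are Lipschitz on bounded subsets of $\mathcal{H}$. (4) $\varepsilon:[t_0,+\infty)\to(0,+\infty)$ is absolutely continuous, nonincreasing, and $\lim_{t\to+\infty}\varepsilon(t)=0$. $U$ strongly convex means that there is $m>0$ such that $y\mapsto U(y)-\frac{m}{2}\|y\|^2$ is convex; such a $U$ has a unique minimizer on every nonempty closed convex subset of $\mathcal{H}$. *)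

theory Defs
  imports "HOL-Analysis.Analysis" "HOL-Library.Landau_Symbols"
begin

definition argmin_set :: "('a \<Rightarrow> real) \<Rightarrow> 'a set" where
  "argmin_set f = {z. f z = (INF y. f y)}"

definition unique_minimizer_on :: "'a set \<Rightarrow> ('a \<Rightarrow> real) \<Rightarrow> 'a \<Rightarrow> bool" where
  "unique_minimizer_on S f p \<longleftrightarrow> (\<forall>q. is_arg_min f (\<lambda>z. z \<in> S) q \<longleftrightarrow> q = p)"

definition strongly_convex :: "('a::real_inner \<Rightarrow> real) \<Rightarrow> bool" where
  "strongly_convex f \<longleftrightarrow> (\<exists>m>0. convex_on UNIV (\<lambda>y. f y - m / 2 * (norm y)\<^sup>2))"

(* C^1 with gradient g: the Riesz representative g x of the Frechet derivative at x
   is unique, so g is determined by f. *)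
definition C1_with_gradient :: "('a::real_inner \<Rightarrow> real) \<Rightarrow> ('a \<Rightarrow> 'a) \<Rightarrow> bool" where
  "C1_with_gradient f g \<longleftrightarrow> (\<forall>x. GDERIV f x :> g x) \<and> continuous_on UNIV g"

definition lipschitz_on_bounded_sets :: "('a::metric_space \<Rightarrow> 'b::metric_space) \<Rightarrow> bool" where
  "lipschitz_on_bounded_sets g \<longleftrightarrow> (\<forall>B. bounded B \<longrightarrow> (\<exists>L. L-lipschitz_on B g))"

(* The usual epsilon-delta notion for a function of one real variable (the library's
   absolutely_continuous is about measures).  The finite family of pairwise
   non-overlapping intervals is {a k..b k} for k < n; the d is uniform in n. *)
definition absolutely_continuous_fun_on :: "real set \<Rightarrow> (real \<Rightarrow> real) \<Rightarrow> bool" where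
  "absolutely_continuous_fun_on I f \<longleftrightarrow>
     (\<forall>e>0. \<exists>d>0. \<forall>(n::nat) a b.
        (\<forall>k<n. a k \<le> b k \<and> {a k..b k} \<subseteq> I) \<and>
        (\<forall>i<n. \<forall>j<n. i \<noteq> j \<longrightarrow> {a i<..<b i} \<inter> {a j<..<b j} = {}) \<and>
        (\<Sum>k<n. b k - a k) < d
        \<longrightarrow> (\<Sum>k<n. \<bar>f (b k) - f (a k)\<bar>) < e)"

(* v and w are the first and second derivatives of x; at the endpoint t0 they are one-sided. *)
definition C2_curve ::
  "real \<Rightarrow> (real \<Rightarrow> 'a::real_normed_vector) \<Rightarrow> (real \<Rightarrow> 'a) \<Rightarrow> (real \<Rightarrow> 'a) \<Rightarrow> bool" where
  "C2_curve t0 x v w \<longleftrightarrow>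
     (\<forall>t\<ge>t0. (x has_vector_derivative v t) (at t within {t0..})) \<and>
     (\<forall>t\<ge>t0. (v has_vector_derivative w t) (at t within {t0..})) \<and>
     continuous_on {t0..} w"

definition energy ::
  "('a::real_normed_vector \<Rightarrow> real) \<Rightarrow> ('a \<Rightarrow> real) \<Rightarrow> (real \<Rightarrow> real) \<Rightarrow> (real \<Rightarrow> 'a) \<Rightarrow> (real \<Rightarrow> 'a)
     \<Rightarrow> real \<Rightarrow> real" where
  "energy \<Phi> U \<epsilon> x v t =
     1 / 2 * (norm (v t))\<^sup>2 + \<Phi> (x t) - (INF y. \<Phi> y) + \<epsilon> t * (U (x t) - (INF y. U y))"

end

(* Put h = |x - p|^2 / 2. Convexity of Phi and m-strong convexity of U turn the equation into a
   differential inequality for E = t^theta h' + (alpha + o(1)) h, namely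
     E' <= C t^theta |x'|^2 - t^theta (Phi(x) - Phi* + eps (U(x) - U(p) + m h)).
   For (Q1) the kinetic term is integrable, so E can only grow by a vanishing amount where
   m h + U(x) - U(p) is bounded below by a positive constant, while there it decreases at a rate
   whose integral t^theta eps diverges. First this bounds h. Then W tends to 0, since otherwise
   E would tend to -oo; hence liminf U(x) >= U(p), and the same argument forces h to 0.
   For (Q2) the kinetic term is absorbed by the dissipation in c t^(1+theta) W + E, which is
   nonincreasing and dominates a multiple of h for a suitable c (this needs alpha > 3 when
   theta = 1). Its decay makes t^theta W and t^theta eps h integrable, and all limits follow. *)

theory Submission
  imports Defs
begin

section \<open>Monotone functions and primitives on a half-line\<close>

text \<open>Multiplying the equation by t^\<theta> and pairing it with x - p turns the damping term
  into \<alpha> h' exactly; hence the weight t^\<theta> in E. In (Q1) what is left is t^\<theta>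
  \<epsilon> times a quantity without a sign, so E need not be monotone. A barrier argument replaces
  monotonicity: a function that has to decrease at a rate of divergent integral whenever it lies
  above a level ends up below that level. Used with other rates, it also excludes positive limits in
  both assertions. The threshold 3 for \<theta> = 1 comes from three demands on c. The dissipation
  absorbs the kinetic terms if c \<alpha> > 3/2; a positive share of t W survives the derivative of
  the weight t^2 if 2 c < 1; the cross term t v.(x - p) is dominated if c (\<alpha> - 1) > 1. The
  first two are compatible exactly when \<alpha> > 3, and together they imply the third.\<close>

lemma tendsto_at_top_if_antimono_bounded_below:
  fixes f :: "real \<Rightarrow> real"
  assumes anti: "\<And>s t. T \<le> s \<Longrightarrow> s \<le> t \<Longrightarrow> f t \<le> f s" and bound: "\<And>t. T \<le> t \<Longrightarrow> B \<le> f t"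
  shows "\<exists>L. (f \<longlongrightarrow> L) at_top \<and> (\<forall>t\<ge>T. L \<le> f t)"
proof -
  define L where "L = Inf (f ` {T..})"
  have bdd: "bdd_below (f ` {T..})"
    using bound by (auto intro!: bdd_belowI[of _ B])
  have lower: "L \<le> f t" if "T \<le> t" for t
    unfolding L_def using bdd that by (intro cInf_lower) auto
  have "(f \<longlongrightarrow> L) at_top"
  proof (rule tendstoI)
    fix e :: real assume "e > 0"
    then obtain s where s: "T \<le> s" "f s < L + e"
      using cInf_lessD[of "f ` {T..}" "L + e"] unfolding L_def by auto
    have "dist (f t) L < e" if "s \<le> t" for t
      using anti[OF s(1) that] lower[of t] s that by (auto simp: dist_real_def)
    then show "\<forall>\<^sub>F t in at_top. dist (f t) L < e"
      unfolding eventually_at_top_linorder by blast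
  qed
  then show ?thesis using lower by blast
qed

lemma DERIV_nonpos_at_top_antimono:
  fixes f :: "real \<Rightarrow> real"
  assumes "\<And>t. T \<le> t \<Longrightarrow> DERIV f t :> f' t" and "\<And>t. T \<le> t \<Longrightarrow> f' t \<le> 0"
    and "T \<le> s" "s \<le> t"
  shows "f t \<le> f s"
proof (rule DERIV_nonpos_imp_nonincreasing[OF \<open>s \<le> t\<close>])
  fix r assume "s \<le> r"
  then show "\<exists>y. DERIV f r :> y \<and> y \<le> 0"
    using assms(1-3) by (intro exI[of _ "f' r"]) auto
qed

text \<open>Freezing the integrand to the left of \<open>a\<close> makes \<open>F\<close> two-sided differentiable at \<open>a\<close>.\<close>

definition primitive_from :: "real \<Rightarrow> (real \<Rightarrow> real) \<Rightarrow> (real \<Rightarrow> real) \<Rightarrow> bool" where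
  "primitive_from a f F \<longleftrightarrow> (\<forall>t. DERIV F t :> f (max a t))"

lemma continuous_max_extension:
  fixes f :: "real \<Rightarrow> real"
  assumes "continuous_on {a..} f"
  shows "continuous_on UNIV (\<lambda>t. f (max a t))"
  by (rule continuous_on_compose2[OF assms]) (auto intro!: continuous_intros)

lemma ex_primitive_from:
  assumes "continuous_on {a..} f"
  shows "\<exists>F. primitive_from a f F"
proof -
  have "isCont (\<lambda>t. f (max a t)) t" for t
    using continuous_max_extension[OF assms] by (auto simp: continuous_on_eq_continuous_at)
  then have "\<exists>F. \<forall>t::real. -\<infinity> < ereal t \<longrightarrow> ereal t < \<infinity> \<longrightarrow>
      (F has_vector_derivative f (max a t)) (at t)"
    by (intro einterval_antiderivative) auto
  then show ?thesis
    by (auto simp: primitive_from_def has_real_derivative_iff_has_vector_derivative)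
qed

lemma primitive_from_DERIV:
  assumes "primitive_from a f F" "a \<le> t"
  shows "DERIV F t :> f t"
  using assms unfolding primitive_from_def by (metis max.absorb2)

lemma primitive_from_mono:
  assumes F: "primitive_from a f F" and nonneg: "\<And>t. a \<le> t \<Longrightarrow> 0 \<le> f t" and "s \<le> t"
  shows "F s \<le> F t"
proof (rule DERIV_nonneg_imp_nondecreasing[OF \<open>s \<le> t\<close>])
  fix r
  show "\<exists>y. DERIV F r :> y \<and> 0 \<le> y"
    using F nonneg by (intro exI[of _ "f (max a r)"]) (auto simp: primitive_from_def)
qed

lemma primitive_from_tendsto:
  assumes F: "primitive_from a f F" and nonneg: "\<And>t. a \<le> t \<Longrightarrow> 0 \<le> f t"
    and bound: "\<And>t. a \<le> t \<Longrightarrow> F t \<le> B"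
  shows "\<exists>L. (F \<longlongrightarrow> L) at_top"
proof -
  have "\<exists>L. ((\<lambda>t. - F t) \<longlongrightarrow> L) at_top \<and> (\<forall>t\<ge>a. L \<le> - F t)"
    using primitive_from_mono[OF F nonneg] bound
    by (intro tendsto_at_top_if_antimono_bounded_below[where B = "-B"]) auto
  then show ?thesis
    by (metis tendsto_minus_cancel_left)
qed

text \<open>Translates the Lebesgue integrals of the theorem into bounds on an antiderivative, the
  form in which the estimates produce them. A bounded monotone antiderivative converges, so the
  fundamental theorem on a half-line gives a finite integral; conversely the integral over
  \<open>{a..}\<close> bounds those over \<open>{a..t}\<close>.\<close>

lemma nn_integral_finite_iff_primitive_bounded:
  assumes cont: "continuous_on {a..} f" and F: "primitive_from a f F"
    and nonneg: "\<And>t. a \<le> t \<Longrightarrow> 0 \<le> f t"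
  shows "(\<integral>\<^sup>+t\<in>{a..}. ennreal (f t) \<partial>lborel) < \<infinity> \<longleftrightarrow> (\<exists>B. \<forall>t\<ge>a. F t \<le> B)"
proof -
  define g where "g t = f (max a t)" for t
  have g_borel: "g \<in> borel_measurable borel"
    unfolding g_def using continuous_max_extension[OF cont] by (rule borel_measurable_continuous_onI)
  have DF: "DERIV F t :> g t" for t
    using F by (simp add: primitive_from_def g_def)
  have g0: "0 \<le> g t" for t
    using nonneg by (simp add: g_def)
  have eq: "(\<integral>\<^sup>+t\<in>{a..}. ennreal (f t) \<partial>lborel) = (\<integral>\<^sup>+t. ennreal (g t) * indicator {a..} t \<partial>lborel)"
    by (intro nn_integral_cong) (auto simp: g_def indicator_def)
  show ?thesis
  proof
    assume "\<exists>B. \<forall>t\<ge>a. F t \<le> B"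
    then obtain L where "(F \<longlongrightarrow> L) at_top"
      using primitive_from_tendsto[OF F nonneg] by blast
    then have "(\<integral>\<^sup>+t. ennreal (g t) * indicator {a..} t \<partial>lborel) = L - F a"
      using g_borel DF g0 by (intro nn_integral_FTC_atLeast)
    then show "(\<integral>\<^sup>+t\<in>{a..}. ennreal (f t) \<partial>lborel) < \<infinity>"
      unfolding eq by simp
  next
    assume "(\<integral>\<^sup>+t\<in>{a..}. ennreal (f t) \<partial>lborel) < \<infinity>"
    then obtain r where r: "0 \<le> r" "(\<integral>\<^sup>+t. ennreal (g t) * indicator {a..} t \<partial>lborel) = ennreal r"
      unfolding eq by (metis ennreal_cases infinity_ennreal_def less_irrefl)
    have "F t \<le> F a + r" if "a \<le> t" for t
    proof -
      have "ennreal (F t - F a) = (\<integral>\<^sup>+s. ennreal (g s) * indicator {a..t} s \<partial>lborel)"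
        using g_borel DF g0 that by (intro nn_integral_FTC_Icc[symmetric])
          (auto intro: has_field_derivative_at_within)
      also have "\<dots> \<le> ennreal r"
        unfolding r(2)[symmetric] by (intro nn_integral_mono) (auto simp: indicator_def)
      finally show ?thesis
        using r(1) by (simp add: ennreal_le_iff)
    qed
    then show "\<exists>B. \<forall>t\<ge>a. F t \<le> B" by blast
  qed
qed

lemma set_integrable_iff_primitive_bounded:
  assumes cont: "continuous_on {a..} f" and F: "primitive_from a f F"
    and nonneg: "\<And>t. a \<le> t \<Longrightarrow> 0 \<le> f t"
  shows "set_integrable lborel {a..} f \<longleftrightarrow> (\<exists>B. \<forall>t\<ge>a. F t \<le> B)"
proof -
  have "(\<lambda>t. indicator {a..} t *\<^sub>R f t) \<in> borel_measurable lborel"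
    using borel_measurable_continuous_on_indicator[OF _ cont] by simp
  moreover have "(\<integral>\<^sup>+t. ennreal (norm (indicator {a..} t *\<^sub>R f t)) \<partial>lborel)
      = (\<integral>\<^sup>+t\<in>{a..}. ennreal (f t) \<partial>lborel)"
    using nonneg by (intro nn_integral_cong) (auto simp: indicator_def)
  ultimately show ?thesis
    using nn_integral_finite_iff_primitive_bounded[OF cont F nonneg]
    by (simp add: set_integrable_def integrable_iff_bounded)
qed

lemma primitive_from_at_top:
  assumes cont: "continuous_on {a..} f" and F: "primitive_from a f F"
    and nonneg: "\<And>t. a \<le> t \<Longrightarrow> 0 \<le> f t"
    and inf: "(\<integral>\<^sup>+t\<in>{a..}. ennreal (f t) \<partial>lborel) = \<infinity>"
  shows "filterlim F at_top at_top"
proof -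
  have "\<exists>t\<ge>a. F t > B" for B
    using nn_integral_finite_iff_primitive_bounded[OF cont F nonneg] inf
    by (auto simp: not_le)
  then show ?thesis
    unfolding filterlim_at_top eventually_at_top_linorder
    by (meson less_imp_le order_trans primitive_from_mono[OF F nonneg])
qed

text \<open>If \<open>G\<close> stayed above \<open>\<beta>\<close>, then \<open>G + F\<close> would
  be nonincreasing and the divergence of \<open>F\<close> would drive \<open>G\<close> to minus
  infinity. Once below \<open>\<beta>\<close>, \<open>G\<close> cannot climb back, since its
  derivative is nonpositive above the level. \<open>F\<close> acts as a clock; later it is a
  multiple of t, of ln t, or of a primitive of t^\<theta> \<epsilon>.\<close>

lemma eventually_le_if_decreasing_above:
  fixes G F e :: "real \<Rightarrow> real"
  assumes G: "\<And>t. T \<le> t \<Longrightarrow> DERIV G t :> G' t"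
    and F: "\<And>t. T \<le> t \<Longrightarrow> DERIV F t :> e t" "filterlim F at_top at_top"
    and e: "\<And>t. T \<le> t \<Longrightarrow> 0 \<le> e t"
    and dec: "\<And>t. T \<le> t \<Longrightarrow> \<beta> \<le> G t \<Longrightarrow> G' t \<le> - e t"
  shows "\<forall>\<^sub>F t in at_top. G t \<le> \<beta>"
proof -
  have "\<exists>t1\<ge>T. G t1 < \<beta>"
  proof (rule ccontr)
    assume "\<not> ?thesis"
    then have above: "\<beta> \<le> G t" if "T \<le> t" for t using that by force
    have "G t + F t \<le> G T + F T" if "T \<le> t" for t
    proof (rule DERIV_nonpos_at_top_antimono[OF _ _ order_refl that])
      fix r assume "T \<le> r"
      then show "DERIV (\<lambda>t. G t + F t) r :> G' r + e r" and "G' r + e r \<le> 0"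
        using G F(1) dec[of r] above[of r] by (auto intro!: derivative_intros)
    qed
    moreover have "\<forall>\<^sub>F t in at_top. F t > G T + F T - \<beta> \<and> t \<ge> T"
      using F(2) by (intro eventually_conj eventually_ge_at_top) (auto simp: filterlim_at_top_dense)
    then obtain t where "F t > G T + F T - \<beta>" "t \<ge> T"
      unfolding eventually_at_top_linorder by blast
    ultimately show False
      using above[of t] by force
  qed
  then obtain t1 where t1: "T \<le> t1" "G t1 < \<beta>" by blast
  have "G t \<le> \<beta>" if "t1 \<le> t" for t
  proof (rule ccontr)
    assume gt: "\<not> G t \<le> \<beta>"
    \<comment> \<open>\<open>Sup S\<close> is the last moment at or below the level, so the mean
      value theorem after it only meets points above the level.\<close>
    define S where "S = {s\<in>{t1..t}. G s \<le> \<beta>}"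
    have "continuous_on {t1..t} G"
      using t1 by (intro continuous_at_imp_continuous_on ballI DERIV_isCont[OF G]) auto
    then have "closed S"
      unfolding S_def by (intro continuous_on_closed_Collect_le) auto
    have "t1 \<in> S" using t1 that by (simp add: S_def)
    moreover have "bdd_above S" unfolding S_def by (auto intro: bdd_aboveI[of _ t])
    ultimately have SupS: "Sup S \<in> S" and upper: "\<And>s. s \<in> S \<Longrightarrow> s \<le> Sup S"
      using closed_contains_Sup[OF _ _ \<open>closed S\<close>] by (auto intro: cSup_upper)
    then have sup: "t1 \<le> Sup S" "Sup S < t" "G (Sup S) \<le> \<beta>"
      using gt by (auto simp: S_def order.strict_iff_order)
    obtain z where z: "Sup S < z" "z < t" "G t - G (Sup S) = (t - Sup S) * G' z"
      using MVT2[of "Sup S" t G G'] G sup t1 by auto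
    have "z \<notin> S" using upper z by force
    then have "\<beta> \<le> G z" using z sup by (auto simp: S_def)
    then have "G' z \<le> 0"
      using dec[of z] e[of z] z sup t1 by force
    then have "G t \<le> G (Sup S)"
      using z(3) sup by (smt (verit) mult_nonneg_nonpos)
    then show False using gt sup by simp
  qed
  then show ?thesis unfolding eventually_at_top_linorder by blast
qed

text \<open>This replaces differentiating \<open>\<epsilon>\<close> almost everywhere: the integrated product rule loses
  the term with \<open>\<epsilon>'\<close>, which has a sign. Over \<open>n\<close> equal pieces the error telescopes
  to a multiple of \<open>(\<epsilon> a - \<epsilon> b) / n\<close>.\<close>

lemma antimono_mult_nonneg_minus_primitive:
  fixes \<epsilon> F F' J :: "real \<Rightarrow> real"
  assumes "a \<le> b" and anti: "antimono_on {a..b} \<epsilon>"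
    and F: "\<And>s. s \<in> {a..b} \<Longrightarrow> DERIV F s :> F' s" "\<And>s. s \<in> {a..b} \<Longrightarrow> 0 \<le> F s"
    and F': "continuous_on {a..b} F'"
    and J: "\<And>s. s \<in> {a..b} \<Longrightarrow> DERIV J s :> \<epsilon> s * F' s"
  shows "\<epsilon> b * F b - J b \<le> \<epsilon> a * F a - J a"
proof -
  have "bounded (F' ` {a..b})"
    using F' by (intro compact_imp_bounded compact_continuous_image) auto
  then obtain M where "M > 0" and M: "\<And>s. s \<in> {a..b} \<Longrightarrow> \<bar>F' s\<bar> \<le> M"
    unfolding bounded_pos by (auto simp: image_iff)
  define \<Delta> where "\<Delta> p = \<epsilon> p * F p - J p" for p
  have step: "\<Delta> q - \<Delta> p \<le> M * (q - p) * (\<epsilon> p - \<epsilon> q)" if pq: "a \<le> p" "p \<le> q" "q \<le> b" for p q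
  proof (cases "p = q")
    case False
    have eps: "\<epsilon> t \<le> \<epsilon> s" if "p \<le> s" "s \<le> t" "t \<le> q" for s t
      using monotone_onD[OF anti, of s t] pq that by simp
    \<comment> \<open>With \<epsilon> frozen at the right end \<open>q\<close>, replacing \<epsilon>
      p by \<epsilon> q in front of \<open>F p\<close> only loses a term of the right sign. The
      remaining error is the length of the piece times the variation of \<epsilon>, hence of second
      order.\<close>
    have "DERIV (\<lambda>s. \<epsilon> q * F s - J s) s :> \<epsilon> q * F' s - \<epsilon> s * F' s" if "p \<le> s" "s \<le> q" for s
      using F(1)[of s] J[of s] pq that by (auto intro!: derivative_eq_intros)
    then obtain z where z: "p < z" "z < q"
      "(\<epsilon> q * F q - J q) - (\<epsilon> q * F p - J p) = (q - p) * (\<epsilon> q * F' z - \<epsilon> z * F' z)"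
      using MVT2[of p q "\<lambda>s. \<epsilon> q * F s - J s" "\<lambda>s. \<epsilon> q * F' s - \<epsilon> s * F' s"] pq False by force
    have "\<epsilon> q * F' z - \<epsilon> z * F' z \<le> \<bar>\<epsilon> q - \<epsilon> z\<bar> * \<bar>F' z\<bar>"
      by (metis abs_ge_self abs_mult left_diff_distrib)
    also have "\<dots> \<le> (\<epsilon> p - \<epsilon> q) * M"
      using eps[of z q] eps[of p z] z pq M[of z] by (intro mult_mono) auto
    finally have "(q - p) * (\<epsilon> q * F' z - \<epsilon> z * F' z) \<le> (q - p) * ((\<epsilon> p - \<epsilon> q) * M)"
      using pq by (intro mult_left_mono) auto
    moreover have "\<epsilon> q * F p \<le> \<epsilon> p * F p"
      using eps[of p q] pq F(2)[of p] by (intro mult_right_mono) auto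
    ultimately show ?thesis
      using z(3) by (simp add: \<Delta>_def algebra_simps)
  qed simp
  have "\<Delta> b - \<Delta> a \<le> M * (b - a) * (\<epsilon> a - \<epsilon> b) / real (Suc n)" for n
  proof -
    define N where "N = real (Suc n)"
    have "N > 0" by (simp add: N_def)
    define p where "p k = a + real k * ((b - a) / N)" for k
    have ends: "p 0 = a" "p (Suc n) = b"
      using \<open>N > 0\<close> by (simp_all add: p_def N_def[symmetric] del: of_nat_Suc)
    have diff: "p (Suc k) - p k = (b - a) / N" for k
      unfolding p_def of_nat_Suc distrib_right by simp
    have piece: "0 \<le> (b - a) / N"
      using \<open>a \<le> b\<close> \<open>N > 0\<close> by simp
    have range: "a \<le> p k" "p k \<le> p (Suc k)" for k
      using piece diff[of k] mult_nonneg_nonneg[OF of_nat_0_le_iff piece, of k]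
      unfolding p_def by linarith+
    have "p k \<le> b" if "k \<le> Suc n" for k
      using lift_Suc_mono_le[of p, OF range(2) that] ends by simp
    then have "\<Delta> (p (Suc k)) - \<Delta> (p k) \<le> M * ((b - a) / N) * (\<epsilon> (p k) - \<epsilon> (p (Suc k)))"
      if "k < Suc n" for k
      using step[of "p k" "p (Suc k)"] range diff[of k] that by simp
    then have "(\<Sum>k<Suc n. \<Delta> (p (Suc k)) - \<Delta> (p k))
        \<le> (\<Sum>k<Suc n. M * ((b - a) / N) * (\<epsilon> (p k) - \<epsilon> (p (Suc k))))"
      by (intro sum_mono) simp
    also have "\<dots> = M * ((b - a) / N) * (\<Sum>k<Suc n. \<epsilon> (p k) - \<epsilon> (p (Suc k)))"
      by (rule sum_distrib_left[symmetric])
    finally show ?thesis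
      using sum_lessThan_telescope[of "\<lambda>k. \<Delta> (p k)" "Suc n"]
        sum_lessThan_telescope'[of "\<lambda>k. \<epsilon> (p k)" "Suc n"]
      unfolding ends N_def by (simp only: times_divide_eq_left times_divide_eq_right)
  qed
  moreover have "(\<lambda>n. M * (b - a) * (\<epsilon> a - \<epsilon> b) / real (Suc n)) \<longlonglongrightarrow> 0"
    using LIMSEQ_Suc[OF lim_const_over_n] .
  ultimately have "\<Delta> b - \<Delta> a \<le> 0"
    by (intro LIMSEQ_le_const) blast+
  then show ?thesis by (simp add: \<Delta>_def)
qed

section \<open>Convex functions on Hilbert space\<close>

text \<open>Restriction to the line through \<open>x\<close> and \<open>y\<close> reduces this to
  the tangent inequality in one variable.\<close>

lemma convex_GDERIV_above_tangent:
  fixes f :: "'a::real_inner \<Rightarrow> real"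
  assumes conv: "convex_on UNIV f" and deriv: "GDERIV f x :> g"
  shows "f x + g \<bullet> (y - x) \<le> f y"
proof -
  define \<phi> where "\<phi> s = f (x + s *\<^sub>R (y - x))" for s :: real
  have "convex_on UNIV \<phi>"
  proof (rule convex_onI)
    fix t a b :: real assume t: "0 < t" "t < 1"
    have "x + ((1 - t) *\<^sub>R a + t *\<^sub>R b) *\<^sub>R (y - x)
        = (1 - t) *\<^sub>R (x + a *\<^sub>R (y - x)) + t *\<^sub>R (x + b *\<^sub>R (y - x))"
      by (simp add: algebra_simps)
    then show "\<phi> ((1 - t) *\<^sub>R a + t *\<^sub>R b) \<le> (1 - t) * \<phi> a + t * \<phi> b"
      unfolding \<phi>_def using convex_onD[OF conv, of t] t by simp
  qed simp
  moreover have "DERIV \<phi> 0 :> g \<bullet> (y - x)"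
  proof -
    have "((\<lambda>s. x + s *\<^sub>R (y - x)) has_derivative (\<lambda>s. s *\<^sub>R (y - x))) (at 0)"
      by (auto intro!: derivative_eq_intros)
    moreover have "(f has_derivative (\<lambda>h. h \<bullet> g)) (at (x + 0 *\<^sub>R (y - x)))"
      using deriv by (simp add: gderiv_def)
    ultimately have "(\<phi> has_derivative (\<lambda>s. (s *\<^sub>R (y - x)) \<bullet> g)) (at 0)"
      unfolding \<phi>_def by (rule has_derivative_compose)
    then show ?thesis
      by (simp add: has_field_derivative_def inner_commute mult.commute[of _ "g \<bullet> (y - x)"])
  qed
  ultimately have "g \<bullet> (y - x) * (1 - 0) \<le> \<phi> 1 - \<phi> 0"
    by (intro convex_on_imp_above_tangent[where A = UNIV]) auto
  then show ?thesis by (simp add: \<phi>_def)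
qed

lemma GDERIV_half_norm_power2: "GDERIV (\<lambda>y. m / 2 * (norm y)\<^sup>2) x :> m *\<^sub>R x"
  unfolding gderiv_def power2_norm_eq_inner
  by (auto intro!: derivative_eq_intros simp: inner_commute)

lemma strongly_convex_above_parabola:
  fixes U :: "'a::real_inner \<Rightarrow> real"
  assumes conv: "convex_on UNIV (\<lambda>y. U y - m / 2 * (norm y)\<^sup>2)" and deriv: "GDERIV U x :> g"
  shows "U x + g \<bullet> (y - x) + m / 2 * (norm (y - x))\<^sup>2 \<le> U y"
proof -
  have "GDERIV (\<lambda>y. U y - m / 2 * (norm y)\<^sup>2) x :> g - m *\<^sub>R x"
    by (intro GDERIV_diff deriv GDERIV_half_norm_power2)
  from convex_GDERIV_above_tangent[OF conv this, of y] show ?thesis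
    by (simp add: power2_norm_eq_inner inner_diff_left inner_diff_right inner_commute algebra_simps)
qed

text \<open>The parallelogram identity gives a quarter of the squared distance as the convexity gap
  of the squared norm at a midpoint; the factor m/2 makes it m/8.\<close>

lemma strongly_convex_midpoint:
  fixes U :: "'a::real_inner \<Rightarrow> real"
  assumes conv: "convex_on UNIV (\<lambda>y. U y - m / 2 * (norm y)\<^sup>2)"
  shows "U (midpoint a b) + m / 8 * (norm (a - b))\<^sup>2 \<le> (U a + U b) / 2"
proof -
  have mid: "midpoint a b = (1 / 2) *\<^sub>R a + (1 / 2) *\<^sub>R b"
    by (simp add: midpoint_def scaleR_add_right)
  have "U (midpoint a b) - m / 2 * (norm (midpoint a b))\<^sup>2
      \<le> 1 / 2 * (U a - m / 2 * (norm a)\<^sup>2) + 1 / 2 * (U b - m / 2 * (norm b)\<^sup>2)"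
    using convex_onD[OF conv, of "1/2" a b] unfolding mid by simp
  then show ?thesis
    unfolding mid by (simp add: power2_norm_eq_inner inner_add_left inner_add_right
        inner_diff_left inner_diff_right inner_commute field_simps)
qed

text \<open>Strong convexity makes near-minimizers over nested convex sets a Cauchy sequence; this
  takes the place of weak compactness.\<close>

lemma strongly_convex_nested_minima:
  fixes U :: "'a::{real_inner, complete_space} \<Rightarrow> real"
  assumes "m > 0" and conv: "convex_on UNIV (\<lambda>y. U y - m / 2 * (norm y)\<^sup>2)"
    and cont: "continuous_on UNIV U" and bdd: "bdd_below (range U)"
    and D: "decseq D" "\<And>n. closed (D n)" "\<And>n. convex (D n)"
    and q: "\<And>n::nat. q \<in> D n"
  shows "\<exists>y. (\<forall>n. y \<in> D n) \<and> (\<lambda>n. Inf (U ` D n)) \<longlonglongrightarrow> U y"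
proof -
  define d where "d n = Inf (U ` D n)" for n
  have bdd': "bdd_below (U ` A)" for A
    using bdd by (rule bdd_below_mono) auto
  have lower: "d n \<le> U y" if "y \<in> D n" for n y
    unfolding d_def using that bdd' by (intro cInf_lower) auto
  have "\<exists>y\<in>D n. U y < d n + 1 / real (Suc n)" for n
    using cInf_lessD[of "U ` D n" "d n + 1 / real (Suc n)"] q[of n] unfolding d_def by auto
  then obtain Y where Y: "\<And>n. Y n \<in> D n" "\<And>n. U (Y n) < d n + 1 / real (Suc n)"
    by metis
  have sub: "D k \<subseteq> D n" if "n \<le> k" for n k
    using D(1) that by (auto simp: decseq_def)
  have "incseq d"
  proof (rule incseq_SucI)
    fix n
    show "d n \<le> d (Suc n)"
      unfolding d_def using q[of "Suc n"] bdd' sub[of n "Suc n"]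
      by (intro cInf_superset_mono) auto
  qed
  then obtain l where l: "d \<longlonglongrightarrow> l" and dl: "\<And>n. d n \<le> l"
    using incseq_convergent[of d "U q"] lower[OF q] by blast
  have close: "(norm (Y i - Y j))\<^sup>2 \<le> 8 / m * (l - d n + 1 / real (Suc n))"
    if "n \<le> i" "n \<le> j" for n i j
  proof -
    have up: "U (Y k) \<le> l + 1 / real (Suc n)" if "n \<le> k" for k
    proof -
      have "1 / real (Suc k) \<le> 1 / real (Suc n)" using that by (intro divide_left_mono) auto
      then show ?thesis using Y(2)[of k] dl[of k] by linarith
    qed
    \<comment> \<open>Convexity of \<open>D n\<close> bounds \<open>U\<close> at the midpoint from
      below by \<open>d n\<close>, while both endpoints have values barely above \<open>l\<close>;
      the gap controls the distance.\<close>
    have "midpoint (Y i) (Y j) \<in> D n"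
      using convexD[OF D(3)[of n], of "Y i" "Y j" "1/2" "1/2"] Y(1) sub that
      by (auto simp: midpoint_def scaleR_add_right)
    then have "m / 8 * (norm (Y i - Y j))\<^sup>2 \<le> l - d n + 1 / real (Suc n)"
      using strongly_convex_midpoint[OF conv, of "Y i" "Y j"] lower[of "midpoint (Y i) (Y j)" n]
        up[OF that(1)] up[OF that(2)] by argo
    from mult_left_mono[OF this, of "8 / m"] show ?thesis
      using \<open>m > 0\<close> by simp
  qed
  have r: "(\<lambda>n. 1 / real (Suc n)) \<longlonglongrightarrow> 0"
    by (rule LIMSEQ_Suc[OF lim_const_over_n])
  have "(\<lambda>n. 8 / m * (l - d n + 1 / real (Suc n))) \<longlonglongrightarrow> 8 / m * (l - l + 0)"
    by (intro tendsto_intros l r)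
  then have err: "(\<lambda>n. 8 / m * (l - d n + 1 / real (Suc n))) \<longlonglongrightarrow> 0"
    by simp
  have "Cauchy Y"
  proof (rule metric_CauchyI)
    fix e :: real assume "e > 0"
    then have "\<forall>\<^sub>F n in sequentially. 8 / m * (l - d n + 1 / real (Suc n)) < e\<^sup>2"
      using order_tendstoD(2)[OF err] by simp
    then obtain n where n: "8 / m * (l - d n + 1 / real (Suc n)) < e\<^sup>2"
      using eventually_happens'[OF sequentially_bot] by blast
    have "dist (Y i) (Y j) < e" if "n \<le> i" "n \<le> j" for i j
    proof -
      have "(dist (Y i) (Y j))\<^sup>2 < e\<^sup>2"
        using close[OF that] n by (simp add: dist_norm)
      then show ?thesis using \<open>e > 0\<close> by (rule power2_less_imp_less[OF _ less_imp_le])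
    qed
    then show "\<exists>M. \<forall>i\<ge>M. \<forall>j\<ge>M. dist (Y i) (Y j) < e" by blast
  qed
  then obtain y where y: "Y \<longlonglongrightarrow> y"
    by (auto simp: Cauchy_convergent_iff convergent_def)
  have yD: "y \<in> D n" for n
    using Y(1) sub by (intro Lim_in_closed_set[OF D(2) _ _ y] eventually_sequentiallyI[of n]) auto
  have "(\<lambda>n. U (Y n)) \<longlonglongrightarrow> U y"
    using continuous_on_tendsto_compose[OF cont y] by simp
  moreover have "(\<lambda>n. U (Y n)) \<longlonglongrightarrow> l"
  proof (rule tendsto_sandwich[OF _ _ l])
    show "(\<lambda>n. d n + 1 / real (Suc n)) \<longlonglongrightarrow> l"
      using tendsto_add[OF l r] by simp
  qed (use lower Y in \<open>auto intro!: always_eventually less_imp_le\<close>)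
  ultimately have "U y = l" by (rule LIMSEQ_unique)
  then show ?thesis using yD l unfolding d_def by blast
qed

text \<open>Existence is the nested statement for a constant sequence of sets, whose infima
  trivially converge to the infimum over \<open>S\<close>. Uniqueness follows because the midpoint
  of two distinct minimizers would do strictly better.\<close>

lemma strongly_convex_unique_minimizer:
  fixes U :: "'a::{real_inner, complete_space} \<Rightarrow> real"
  assumes "m > 0" and conv: "convex_on UNIV (\<lambda>y. U y - m / 2 * (norm y)\<^sup>2)"
    and cont: "continuous_on UNIV U" and bdd: "bdd_below (range U)"
    and S: "closed S" "convex S" "S \<noteq> {}"
  shows "\<exists>p. unique_minimizer_on S U p"
proof -
  obtain q where "q \<in> S" using S by blast
  then obtain p where p: "p \<in> S" "\<And>y. y \<in> S \<Longrightarrow> U p \<le> U y"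
  proof -
    obtain y where y: "y \<in> S" "(\<lambda>n::nat. Inf (U ` S)) \<longlonglongrightarrow> U y"
      using strongly_convex_nested_minima[OF \<open>m > 0\<close> conv cont bdd, of "\<lambda>_. S" q] S \<open>q \<in> S\<close>
      by (auto simp: decseq_def)
    then have "U y = Inf (U ` S)" by (simp add: LIMSEQ_const_iff)
    then have "U y \<le> U z" if "z \<in> S" for z
      using that bdd_below_mono[OF bdd, of "U ` S"] by (auto intro: cInf_lower)
    then show thesis by (rule that[OF y(1)])
  qed
  have "q = p" if "is_arg_min U (\<lambda>z. z \<in> S) q" for q
  proof -
    have q: "q \<in> S" "U q \<le> U p"
      using that p by (auto simp: is_arg_min_linorder)
    have "midpoint q p \<in> S"
      using convexD[OF S(2) q(1) p(1), of "1/2" "1/2"] by (auto simp: midpoint_def scaleR_add_right)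
    then have "m / 8 * (norm (q - p))\<^sup>2 \<le> 0"
      using strongly_convex_midpoint[OF conv, of q p] p(2) q(2) by fastforce
    then show ?thesis using \<open>m > 0\<close> by (simp add: mult_le_0_iff)
  qed
  moreover have "is_arg_min U (\<lambda>z. z \<in> S) p"
    using p by (auto simp: is_arg_min_linorder)
  ultimately show ?thesis unfolding unique_minimizer_on_def by blast
qed

lemma sublevel_closed_convex:
  fixes f :: "'a::real_inner \<Rightarrow> real"
  assumes "convex_on UNIV f" "continuous_on UNIV f"
  shows "closed {y. f y \<le> c}" "convex {y. f y \<le> c}"
proof -
  show "closed {y. f y \<le> c}"
    using assms by (intro closed_Collect_le) auto
  show "convex {y. f y \<le> c}"
  proof (rule convexI)
    fix y z u v assume yz: "y \<in> {y. f y \<le> c}" "z \<in> {y. f y \<le> c}"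
      and uv: "0 \<le> u" "0 \<le> v" "u + v = (1::real)"
    have "f (u *\<^sub>R y + v *\<^sub>R z) \<le> u * f y + v * f z"
      using assms(1) uv by (auto simp: convex_on_def)
    also have "\<dots> \<le> u * c + v * c"
      using yz uv by (intro add_mono mult_left_mono) auto
    finally show "u *\<^sub>R y + v *\<^sub>R z \<in> {y. f y \<le> c}"
      using uv by (simp flip: distrib_right)
  qed
qed

lemma absolutely_continuous_fun_on_imp_continuous_on:
  assumes ac: "absolutely_continuous_fun_on I f" and I: "is_interval I"
  shows "continuous_on I f"
  unfolding continuous_on_iff
proof (intro ballI allI impI)
  fix s e :: real assume s: "s \<in> I" and e: "e > 0"
  obtain d where "d > 0" and d: "\<forall>(n::nat) a b.
        (\<forall>k<n. a k \<le> b k \<and> {a k..b k} \<subseteq> I) \<and>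
        (\<forall>i<n. \<forall>j<n. i \<noteq> j \<longrightarrow> {a i<..<b i} \<inter> {a j<..<b j} = {}) \<and>
        (\<Sum>k<n. b k - a k) < d
        \<longrightarrow> (\<Sum>k<n. \<bar>f (b k) - f (a k)\<bar>) < e"
    using ac[unfolded absolutely_continuous_fun_on_def, THEN spec, THEN mp, OF e]
    by (elim exE conjE) (rule that)
  have "dist (f t) (f s) < e" if t: "t \<in> I" "dist t s < d" for t
  proof -
    have "{min s t..max s t} \<subseteq> I"
      using mem_is_interval_1_I[OF I s t(1)] mem_is_interval_1_I[OF I t(1) s]
      by (cases "s \<le> t") auto
    moreover have "max s t - min s t < d"
      using t(2) by (cases "s \<le> t") (auto simp: dist_real_def)
    \<comment> \<open>A family consisting of one interval is enough for continuity.\<close>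
    ultimately have "\<bar>f (max s t) - f (min s t)\<bar> < e"
      using d[rule_format, of 1 "\<lambda>_. min s t" "\<lambda>_. max s t"] by simp
    then show ?thesis by (cases "s \<le> t") (auto simp: dist_real_def)
  qed
  then show "\<exists>d>0. \<forall>t\<in>I. dist t s < d \<longrightarrow> dist (f t) (f s) < e"
    using \<open>d > 0\<close> by blast
qed

section \<open>The damped inertial dynamics\<close>

lemma GDERIV_compose_curve:
  assumes f: "GDERIV f (x t) :> g" and x: "(x has_vector_derivative v) (at t)"
  shows "DERIV (\<lambda>t. f (x t)) t :> g \<bullet> v"
proof -
  have "((\<lambda>t. f (x t)) has_derivative (\<lambda>s. (s *\<^sub>R v) \<bullet> g)) (at t)"
    using has_derivative_compose[of x "\<lambda>s. s *\<^sub>R v" t UNIV f "\<lambda>h. h \<bullet> g"] f x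
    by (simp add: gderiv_def has_vector_derivative_def)
  then show ?thesis
    by (simp add: has_field_derivative_def inner_commute mult.commute[of _ "g \<bullet> v"])
qed

lemma C1_with_gradient_continuous_on: "C1_with_gradient f g \<Longrightarrow> continuous_on A f"
  unfolding C1_with_gradient_def gderiv_def
  by (meson continuous_at_imp_continuous_on has_derivative_continuous)

text \<open>The hypotheses in working form: \<open>m\<close> is one fixed modulus of strong
  convexity, and the damping coefficient is replaced by its formula. The condition
  \<open>slow\<close> keeps the vanishing term strong enough to select a minimizer of
  \<open>U\<close>.\<close>

locale inertial_trajectory =
  fixes \<Phi> U :: "'a::{real_inner, complete_space} \<Rightarrow> real"
    and g\<Phi> gU :: "'a \<Rightarrow> 'a"
    and \<epsilon> :: "real \<Rightarrow> real"
    and t0 \<alpha> \<theta> m :: real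
    and x v w :: "real \<Rightarrow> 'a"
  assumes t0_pos: "0 < t0"
    and \<Phi>_convex: "convex_on UNIV \<Phi>" and \<Phi>_C1: "C1_with_gradient \<Phi> g\<Phi>"
    and \<Phi>_bdd: "bdd_below (range \<Phi>)"
    and U_C1: "C1_with_gradient U gU" and U_bdd: "bdd_below (range U)"
    and m_pos: "0 < m" and U_convex: "convex_on UNIV (\<lambda>y. U y - m / 2 * (norm y)\<^sup>2)"
    and \<epsilon>_pos: "\<And>t. t0 \<le> t \<Longrightarrow> 0 < \<epsilon> t" and \<epsilon>_cont: "continuous_on {t0..} \<epsilon>"
    and \<epsilon>_antimono: "antimono_on {t0..} \<epsilon>" and \<epsilon>_lim: "(\<epsilon> \<longlongrightarrow> 0) at_top"
    and \<theta>: "0 \<le> \<theta>" "\<theta> \<le> 1"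
    and \<alpha>: "\<theta> < 1 \<Longrightarrow> 0 < \<alpha>" "\<theta> = 1 \<Longrightarrow> 3 < \<alpha>"
    and slow: "(\<integral>\<^sup>+t\<in>{t0..}. ennreal (t powr \<theta> * \<epsilon> t) \<partial>lborel) = \<infinity>"
    and curve: "C2_curve t0 x v w"
    and ode: "\<And>t. t0 \<le> t \<Longrightarrow>
      w t + (\<alpha> / t powr \<theta>) *\<^sub>R v t + g\<Phi> (x t) + \<epsilon> t *\<^sub>R gU (x t) = 0"
begin

lemma \<alpha>_pos: "0 < \<alpha>"
  using \<alpha> \<theta>(2) by (cases "\<theta> = 1") auto

text \<open>Only the one-sided derivatives are given at \<open>t0\<close>, so two-sided ones, and
  the arguments built on them, live strictly to the right of \<open>t0\<close>.\<close>

lemma x_deriv: "t0 < t \<Longrightarrow> (x has_vector_derivative v t) (at t)"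
  and v_deriv: "t0 < t \<Longrightarrow> (v has_vector_derivative w t) (at t)"
  using curve by (auto simp: C2_curve_def at_within_interior[of t "{t0..}"] dest!: spec[of _ t])

lemma continuous_trajectory:
  "continuous_on {t0..} x" "continuous_on {t0..} v" "continuous_on {t0..} w"
  using curve unfolding C2_curve_def
  by (auto simp: continuous_on_eq_continuous_within intro: has_vector_derivative_continuous)

lemma gradients: "GDERIV \<Phi> y :> g\<Phi> y" "GDERIV U y :> gU y"
  using \<Phi>_C1 U_C1 by (auto simp: C1_with_gradient_def)

lemma continuous_potentials:
  "continuous_on A \<Phi>" "continuous_on A U" "continuous_on A g\<Phi>" "continuous_on A gU"
  using \<Phi>_C1 U_C1 C1_with_gradient_continuous_on
  by (auto simp: C1_with_gradient_def intro: continuous_on_subset)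

lemma continuous_along:
  "continuous_on {t0..} (\<lambda>t. \<Phi> (x t))" "continuous_on {t0..} (\<lambda>t. U (x t))"
  "continuous_on {t0..} (\<lambda>t. gU (x t))"
  using continuous_trajectory(1)
  by (auto intro: continuous_on_compose2[OF continuous_potentials(1)]
      continuous_on_compose2[OF continuous_potentials(2)]
      continuous_on_compose2[OF continuous_potentials(4)])

lemma continuous_powr: "continuous_on {t0..} (\<lambda>t. t powr r)"
  using t0_pos by (intro continuous_intros) auto

abbreviation \<Phi>min :: real where "\<Phi>min \<equiv> (INF y. \<Phi> y)"
abbreviation Umin :: real where "Umin \<equiv> (INF y. U y)"

lemma \<Phi>min_le: "\<Phi>min \<le> \<Phi> y" and Umin_le: "Umin \<le> U y"
  using \<Phi>_bdd U_bdd by (auto intro: cINF_lower)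

abbreviation W :: "real \<Rightarrow> real" where "W \<equiv> energy \<Phi> U \<epsilon> x v"

lemma potential_gap_nonneg: "t0 \<le> t \<Longrightarrow> 0 \<le> \<epsilon> t * (U (x t) - Umin)"
  using less_imp_le[OF \<epsilon>_pos] Umin_le[of "x t"] by simp

lemma W_nonneg: "t0 \<le> t \<Longrightarrow> 0 \<le> W t"
  and \<Phi>_le_W: "t0 \<le> t \<Longrightarrow> \<Phi> (x t) - \<Phi>min \<le> W t"
  and kinetic_le_W: "t0 \<le> t \<Longrightarrow> (norm (v t))\<^sup>2 / 2 \<le> W t"
  using potential_gap_nonneg[of t] \<Phi>min_le[of "x t"] zero_le_power2[of "norm (v t)"]
  unfolding energy_def by linarith+

lemma continuous_W: "continuous_on {t0..} W"
  unfolding energy_def[abs_def]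
  by (intro continuous_intros continuous_trajectory continuous_along \<epsilon>_cont)

text \<open>Formally the derivative of t^r W is the left side of the hypothesis on \<open>j\<close>
  plus t^r \<epsilon>' (U - Umin), which is nonpositive. Since \<epsilon> is not differentiated, the
  comparison is stated in integrated form, with \<open>J\<close> an antiderivative of any majorant
  of the formal rate. Exponent 0 gives the decay of \<open>W\<close>, exponent 1 + \<theta> the
  estimates for (Q2).\<close>

lemma weighted_energy_decreasing:
  assumes ab: "t0 < a" "a \<le> b"
    and J: "\<And>s. a \<le> s \<Longrightarrow> s \<le> b \<Longrightarrow> DERIV J s :> j s"
    and j: "\<And>s. a \<le> s \<Longrightarrow> s \<le> b \<Longrightarrow>
      r * s powr (r - 1) * W s - \<alpha> * s powr (r - \<theta>) * (norm (v s))\<^sup>2 \<le> j s"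
  shows "b powr r * W b - J b \<le> a powr r * W a - J a"
proof -
  define p where "p s = r * s powr (r - 1) * W s - \<alpha> * s powr (r - \<theta>) * (norm (v s))\<^sup>2" for s
  have "continuous_on {t0..} p"
    unfolding p_def[abs_def]
    by (intro continuous_intros continuous_powr continuous_W continuous_trajectory)
  then obtain P where P: "primitive_from t0 p P" using ex_primitive_from by blast
  have DP: "DERIV P s :> p s" if "a \<le> s" for s
    using primitive_from_DERIV[OF P] ab that by simp
  have "P b - J b \<le> P a - J a"
  proof (rule DERIV_nonpos_imp_nonincreasing[OF ab(2)])
    fix s assume "a \<le> s" "s \<le> b"
    then show "\<exists>y. DERIV (\<lambda>t. P t - J t) s :> y \<and> y \<le> 0"
      using DP[of s] J[of s] j[of s] by (intro exI[of _ "p s - j s"]) (auto simp: p_def intro!: derivative_intros)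
  qed
  define K where "K s = s powr r * (1 / 2 * (v s \<bullet> v s) + \<Phi> (x s) - \<Phi>min)" for s
  define F where "F s = s powr r * (U (x s) - Umin)" for s
  define F' where "F' s = r * s powr (r - 1) * (U (x s) - Umin) + s powr r * (gU (x s) \<bullet> v s)" for s
  have W_eq: "s powr r * W s = K s + \<epsilon> s * F s" for s
    by (simp add: energy_def K_def F_def power2_norm_eq_inner algebra_simps)
  \<comment> \<open>Here t^r W = K + \<epsilon> F, with \<open>K\<close> and \<open>F\<close>
    differentiable. By the equation, the formal rate minus the derivative of \<open>K\<close> is
    \<epsilon> F', so \<open>P - K\<close> plays the role of \<open>J\<close> in the product
    inequality.\<close>
  have "\<epsilon> b * F b - (P b - K b) \<le> \<epsilon> a * F a - (P a - K a)"
  proof (rule antimono_mult_nonneg_minus_primitive[OF ab(2)])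
    show "antimono_on {a..b} \<epsilon>"
      using \<epsilon>_antimono by (rule monotone_on_subset) (use ab in auto)
    have "continuous_on {t0..} F'"
      unfolding F'_def[abs_def]
      by (intro continuous_intros continuous_powr continuous_trajectory continuous_along)
    then show "continuous_on {a..b} F'"
      by (rule continuous_on_subset) (use ab in auto)
    fix s assume s: "s \<in> {a..b}"
    then have st: "t0 < s" "0 < s" using ab t0_pos by auto
    show "0 \<le> F s" using Umin_le by (simp add: F_def)
    have Dpow: "DERIV (\<lambda>s. s powr r) s :> r * s powr (r - 1)"
      using st by (intro has_real_derivative_powr)
    show "DERIV F s :> F' s"
      unfolding F_def[abs_def] F'_def
      by (rule DERIV_cong, rule DERIV_mult[OF Dpow DERIV_diff[OF
            GDERIV_compose_curve[OF gradients(2) x_deriv[OF st(1)]] DERIV_const]])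
        (simp add: algebra_simps)
    have "DERIV (\<lambda>s. v s \<bullet> v s) s :> w s \<bullet> v s + v s \<bullet> w s"
      using bounded_bilinear.has_vector_derivative[OF bounded_bilinear_inner v_deriv v_deriv, OF st(1) st(1)]
      by (simp add: has_real_derivative_iff_has_vector_derivative add.commute)
    then have "DERIV (\<lambda>s. v s \<bullet> v s) s :> 2 * (w s \<bullet> v s)"
      by (simp add: inner_commute)
    then have "DERIV K s :> r * s powr (r - 1) * (1 / 2 * (v s \<bullet> v s) + \<Phi> (x s) - \<Phi>min)
        + s powr r * (w s \<bullet> v s + g\<Phi> (x s) \<bullet> v s)"
      unfolding K_def[abs_def]
      by (intro DERIV_cong[OF DERIV_mult[OF Dpow DERIV_diff[OF DERIV_add[OF DERIV_cmult
            GDERIV_compose_curve[OF gradients(1) x_deriv[OF st(1)]]] DERIV_const]]])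
        (auto simp: algebra_simps)
    moreover have "w s \<bullet> v s = - (\<alpha> / s powr \<theta>) * (v s \<bullet> v s) - g\<Phi> (x s) \<bullet> v s - \<epsilon> s * (gU (x s) \<bullet> v s)"
    proof -
      have "w s = - ((\<alpha> / s powr \<theta>) *\<^sub>R v s) - g\<Phi> (x s) - \<epsilon> s *\<^sub>R gU (x s)"
        using ode[of s] st by (simp add: algebra_simps eq_neg_iff_add_eq_0)
      then show ?thesis by (simp add: inner_diff_left inner_minus_left)
    qed
    moreover have "s powr (r - \<theta>) = s powr r / s powr \<theta>"
      by (rule powr_diff)
    ultimately show "DERIV (\<lambda>s. P s - K s) s :> \<epsilon> s * F' s"
      using DP[of s] s
      by (auto intro!: derivative_eq_intros simp: p_def F'_def energy_def power2_norm_eq_inner algebra_simps)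
  qed
  then show ?thesis
    using \<open>P b - J b \<le> P a - J a\<close> by (simp add: W_eq)
qed

section \<open>The function E attached to a reference point p\<close>

definition h :: "'a \<Rightarrow> real \<Rightarrow> real" where
  "h p t = (norm (x t - p))\<^sup>2 / 2"

text \<open>The correction \<open>\<mu> t powr (\<theta> - 1)\<close> pays for the term
  \<open>\<theta> t powr (\<theta> - 1) h'\<close> that arises from \<open>(t powr \<theta> h')'\<close>.\<close>

definition \<mu> :: real where "\<mu> = (if \<theta> = 1 then - 1 else 1)"
text \<open>For \<theta> < 1, \<open>C - 1\<close> is the least constant with (1 + \<theta>) v.q -
  (1 - \<theta>)/2 |q|^2 bounded by (C - 1) |v|^2 for all v and q; it is used with q = (x - p)/t.
  The summand 1 is the kinetic term from differentiating v.(x - p).\<close>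

definition C :: real where "C = (if \<theta> = 1 then 1 else 1 + (1 + \<theta>)\<^sup>2 / (2 * (1 - \<theta>)))"
definition A :: "real \<Rightarrow> real" where "A t = \<alpha> + \<mu> * t powr (\<theta> - 1)"
definition Ainf :: real where "Ainf = (if \<theta> = 1 then \<alpha> - 1 else \<alpha>)"
definition E :: "'a \<Rightarrow> real \<Rightarrow> real" where
  "E p t = t powr \<theta> * (v t \<bullet> (x t - p)) + A t * h p t"
definition E' :: "'a \<Rightarrow> real \<Rightarrow> real" where
  "E' p t = \<theta> * t powr (\<theta> - 1) * (v t \<bullet> (x t - p)) + t powr \<theta> * (w t \<bullet> (x t - p) + v t \<bullet> v t)
    + \<mu> * ((\<theta> - 1) * t powr (\<theta> - 2)) * h p t + A t * (v t \<bullet> (x t - p))"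

lemma h_nonneg: "0 \<le> h p t" by (simp add: h_def)

lemma C_ge_1: "1 \<le> C"
  using \<theta> by (auto simp: C_def)

lemma Ainf_pos: "0 < Ainf"
  using \<alpha> \<alpha>_pos by (auto simp: Ainf_def)

lemma powr_neg_tendsto: "\<theta> < 1 \<Longrightarrow> ((\<lambda>t. t powr (\<theta> - 1)) \<longlongrightarrow> 0) at_top"
  by (intro tendsto_neg_powr filterlim_ident) auto

lemma A_tendsto: "(A \<longlongrightarrow> Ainf) at_top"
proof (cases "\<theta> = 1")
  case True
  have "\<forall>\<^sub>F t in at_top. Ainf = A t"
    using eventually_gt_at_top[of 0]
  proof eventually_elim
    case (elim t)
    then show ?case unfolding A_def Ainf_def \<mu>_def by (simp add: True)
  qed
  then show ?thesis by (rule Lim_transform_eventually[OF tendsto_const])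
next
  case False
  then have "((\<lambda>t. \<alpha> + \<mu> * t powr (\<theta> - 1)) \<longlongrightarrow> \<alpha> + \<mu> * 0) at_top"
    using \<theta> by (intro tendsto_intros powr_neg_tendsto) auto
  then show ?thesis by (simp add: A_def[abs_def] Ainf_def False)
qed

lemma E_DERIV:
  assumes t: "t0 < t"
  shows "DERIV (E p) t :> E' p t"
proof -
  have "t > 0" using t t0_pos by simp
  have D1: "DERIV (\<lambda>t. v t \<bullet> (x t - p)) t :> w t \<bullet> (x t - p) + v t \<bullet> v t"
  proof -
    have "((\<lambda>t. x t - p) has_vector_derivative v t) (at t)"
      using x_deriv[OF t] by (auto intro!: derivative_eq_intros)
    from bounded_bilinear.has_vector_derivative[OF bounded_bilinear_inner v_deriv[OF t] this]
    show ?thesis by (simp add: has_real_derivative_iff_has_vector_derivative add.commute)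
  qed
  have D2: "DERIV (h p) t :> v t \<bullet> (x t - p)"
  proof -
    have "((\<lambda>t. x t - p) has_vector_derivative v t) (at t)"
      using x_deriv[OF t] by (auto intro!: derivative_eq_intros)
    from bounded_bilinear.has_vector_derivative[OF bounded_bilinear_inner this this]
    have "DERIV (\<lambda>t. (x t - p) \<bullet> (x t - p)) t :> 2 * (v t \<bullet> (x t - p))"
      by (simp add: has_real_derivative_iff_has_vector_derivative inner_commute)
    then have "DERIV (\<lambda>t. (x t - p) \<bullet> (x t - p) / 2) t :> v t \<bullet> (x t - p)"
      by (auto intro!: derivative_eq_intros)
    then show ?thesis by (simp add: h_def[abs_def] power2_norm_eq_inner)
  qed
  have Dpow: "DERIV (\<lambda>s. s powr r) t :> r * t powr (r - 1)" for r
    using \<open>t > 0\<close> by (intro has_real_derivative_powr)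
  have "DERIV A t :> \<mu> * ((\<theta> - 1) * t powr (\<theta> - 2))"
    unfolding A_def[abs_def]
    by (rule DERIV_cong, rule DERIV_add[OF DERIV_const DERIV_cmult[OF Dpow]]) simp
  from DERIV_add[OF DERIV_mult[OF Dpow[of \<theta>] D1] DERIV_mult[OF this D2]]
  show ?thesis unfolding E_def[abs_def] E'_def by (rule DERIV_cong) (simp add: algebra_simps)
qed

text \<open>The \<alpha> terms cancel between the damping and the derivative of \<alpha> h. The
  gradients, paired with x - p, are bounded below by the tangent inequality for
  \<open>\<Phi>\<close> and its strongly convex version for \<open>U\<close>.\<close>

lemma E'_le:
  assumes t: "t0 < t" and p: "\<Phi> p = \<Phi>min"
  shows "E' p t \<le> C * (t powr \<theta> * (norm (v t))\<^sup>2) - t powr \<theta> * (\<Phi> (x t) - \<Phi>min)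
    - t powr \<theta> * \<epsilon> t * (U (x t) - U p + m * h p t)"
proof -
  define d where "d = x t - p"
  define y where "y = t powr \<theta>"
  have "t > 0" using t t0_pos by simp
  then have y: "y > 0" "t powr (\<theta> - 1) = y / t" "t powr (\<theta> - 2) = y / t\<^sup>2"
    by (simp_all add: y_def powr_diff powr_numeral)
  have hd: "h p t = (d \<bullet> d) / 2" by (simp add: h_def d_def power2_norm_eq_inner)
  have \<Phi>_ge: "\<Phi> (x t) - \<Phi>min \<le> g\<Phi> (x t) \<bullet> d"
    using convex_GDERIV_above_tangent[OF \<Phi>_convex gradients(1), of "x t" p]
    unfolding p d_def by (simp add: inner_diff_right)
  have U_ge: "U (x t) - U p + m * h p t \<le> gU (x t) \<bullet> d"
    using strongly_convex_above_parabola[OF U_convex gradients(2), of "x t" p]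
    unfolding h_def d_def norm_minus_commute[of p] by (simp add: inner_diff_right)
  have "w t = - ((\<alpha> / y) *\<^sub>R v t) - g\<Phi> (x t) - \<epsilon> t *\<^sub>R gU (x t)"
    using ode[of t] t unfolding y_def by (simp add: algebra_simps eq_neg_iff_add_eq_0)
  then have "w t \<bullet> d = - (\<alpha> / y) * (v t \<bullet> d) - g\<Phi> (x t) \<bullet> d - \<epsilon> t * (gU (x t) \<bullet> d)"
    by (simp add: inner_diff_left inner_minus_left)
  then have yw: "y * (w t \<bullet> d) = - \<alpha> * (v t \<bullet> d) - y * (g\<Phi> (x t) \<bullet> d) - y * (\<epsilon> t * (gU (x t) \<bullet> d))"
    using y(1) by (simp add: field_simps)
  \<comment> \<open>\<open>R\<close> collects what comes from differentiating the weight t^\<theta>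
    and from the correction in \<open>A\<close>. For \<theta> = 1 both coefficients vanish because
    \<mu> = -1; for \<theta> < 1 the second one is a negative multiple of \<open>h\<close>, which
    pays for the cross term.\<close>
  define R where "R = (\<theta> + \<mu>) * (y / t) * (v t \<bullet> d) + \<mu> * ((\<theta> - 1) * (y / t\<^sup>2)) * h p t"
  have "E' p t = y * (v t \<bullet> v t) - y * (g\<Phi> (x t) \<bullet> d) - y * (\<epsilon> t * (gU (x t) \<bullet> d)) + R"
    unfolding E'_def A_def y(2,3) y_def[symmetric] d_def[symmetric] R_def distrib_left yw
    by (simp add: algebra_simps)
  moreover have "R \<le> (C - 1) * (y * (v t \<bullet> v t))"
  proof (cases "\<theta> = 1")
    case False
    then have \<theta>1: "1 - \<theta> > 0" using \<theta> by simp
    \<comment> \<open>The factor that turns the quadratic form in v and (x - p)/t into a multiple of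
      the perfect square of \<open>s *\<^sub>R v t - q\<close>.\<close>
    define s where "s = (1 + \<theta>) / (1 - \<theta>)"
    have s: "(1 - \<theta>) * s = 1 + \<theta>" using \<theta>1 by (simp add: s_def)
    have C1: "C - 1 = (1 - \<theta>) / 2 * s\<^sup>2"
    proof -
      have "(1 - \<theta>) / 2 * s\<^sup>2 = ((1 - \<theta>) * s) * s / 2"
        by (simp add: power2_eq_square)
      then show ?thesis
        unfolding s C_def using False by (simp add: s_def power2_eq_square)
    qed
    define q where "q = (1 / t) *\<^sub>R d"
    have q: "v t \<bullet> q = (v t \<bullet> d) / t" "q \<bullet> q = (d \<bullet> d) / t\<^sup>2"
      by (simp_all add: q_def power2_eq_square)
    have "(1 - \<theta>) / 2 * s\<^sup>2 * (v t \<bullet> v t) - ((1 - \<theta>) * s) * (v t \<bullet> q) + (1 - \<theta>) / 2 * (q \<bullet> q)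
      = (1 - \<theta>) / 2 * (norm (s *\<^sub>R v t - q))\<^sup>2"
      unfolding power2_norm_eq_inner
      by (simp add: inner_diff_left inner_diff_right inner_commute power2_eq_square field_simps)
    moreover have "(1 - \<theta>) / 2 * (norm (s *\<^sub>R v t - q))\<^sup>2 \<ge> 0"
      using \<theta>1 by simp
    ultimately have "(1 + \<theta>) * (v t \<bullet> q) - (1 - \<theta>) / 2 * (q \<bullet> q) \<le> (C - 1) * (v t \<bullet> v t)"
      unfolding C1 s by linarith
    from mult_left_mono[OF this less_imp_le[OF y(1)]]
    have "y * ((1 + \<theta>) * (v t \<bullet> q) - (1 - \<theta>) / 2 * (q \<bullet> q)) \<le> (C - 1) * (y * (v t \<bullet> v t))"
      by (simp only: mult.left_commute)
    moreover have "R = (\<theta> + 1) * (y * (v t \<bullet> q)) + (\<theta> - 1) * (y * ((q \<bullet> q) / 2))"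
      unfolding R_def hd q \<mu>_def using False by simp
    ultimately show ?thesis by (simp add: algebra_simps diff_divide_distrib)
  next
    case True
    then have "C = 1" "\<mu> = - 1" unfolding C_def \<mu>_def by simp_all
    then show ?thesis unfolding R_def \<open>C = 1\<close> \<open>\<mu> = - 1\<close> using True by simp
  qed
  moreover have "y * (\<Phi> (x t) - \<Phi>min) \<le> y * (g\<Phi> (x t) \<bullet> d)"
    using \<Phi>_ge y(1) by (intro mult_left_mono) auto
  moreover have "y * (\<epsilon> t * (U (x t) - U p + m * h p t)) \<le> y * (\<epsilon> t * (gU (x t) \<bullet> d))"
    using U_ge y(1) \<epsilon>_pos[of t] t by (intro mult_left_mono) auto
  ultimately show ?thesis
    unfolding y_def[symmetric] power2_norm_eq_inner by (simp add: algebra_simps)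
qed

text \<open>Once t^\<theta> |v| tends to 0 and \<open>h\<close> is bounded, this makes
  \<open>E\<close> asymptotically equal to \<open>A\<close> times \<open>h\<close>, so information
  on \<open>E\<close> passes to the distance.\<close>

lemma E_minus_Ah: "\<bar>E p t - A t * h p t\<bar> \<le> t powr \<theta> * norm (v t) * norm (x t - p)"
proof -
  have "\<bar>v t \<bullet> (x t - p)\<bar> \<le> norm (v t) * norm (x t - p)"
    by (rule Cauchy_Schwarz_ineq2)
  then show ?thesis
    by (simp add: E_def abs_mult mult.assoc mult_left_mono)
qed

lemma norm_eq_sqrt_h: "norm (x t - p) = sqrt (2 * h p t)"
  by (simp add: h_def)

lemma tendsto_if_h_tendsto_0:
  assumes "(h p \<longlongrightarrow> 0) at_top"
  shows "(x \<longlongrightarrow> p) at_top"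
proof -
  have "((\<lambda>t. sqrt (2 * h p t)) \<longlongrightarrow> sqrt (2 * 0)) at_top"
    by (intro tendsto_intros assms)
  then have "((\<lambda>t. norm (x t - p)) \<longlongrightarrow> 0) at_top"
    by (simp add: norm_eq_sqrt_h)
  then show ?thesis
    by (simp add: tendsto_norm_zero_iff LIM_zero_iff)
qed

lemma cross_term_tendsto_0:
  assumes u: "((\<lambda>t. t powr \<theta> * norm (v t)) \<longlongrightarrow> 0) at_top"
    and H: "\<forall>\<^sub>F t in at_top. h p t \<le> H"
  shows "((\<lambda>t. E p t - A t * h p t) \<longlongrightarrow> 0) at_top"
proof (rule Lim_null_comparison)
  show "\<forall>\<^sub>F t in at_top. norm (E p t - A t * h p t) \<le> t powr \<theta> * norm (v t) * sqrt (2 * H)"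
    using H
  proof eventually_elim
    case (elim t)
    then have "norm (x t - p) \<le> sqrt (2 * H)" by (simp add: norm_eq_sqrt_h)
    then have "t powr \<theta> * norm (v t) * norm (x t - p) \<le> t powr \<theta> * norm (v t) * sqrt (2 * H)"
      by (intro mult_left_mono) auto
    then show ?case using E_minus_Ah[of p t] by simp
  qed
  show "((\<lambda>t. t powr \<theta> * norm (v t) * sqrt (2 * H)) \<longlongrightarrow> 0) at_top"
    using tendsto_mult_right[OF u, of "sqrt (2 * H)"] by simp
qed

lemma slow_primitive:
  obtains P where "primitive_from t0 (\<lambda>t. t powr \<theta> * \<epsilon> t) P" "filterlim P at_top at_top"
proof -
  have cont: "continuous_on {t0..} (\<lambda>t. t powr \<theta> * \<epsilon> t)"
    by (intro continuous_intros continuous_powr \<epsilon>_cont)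
  then obtain P where P: "primitive_from t0 (\<lambda>t. t powr \<theta> * \<epsilon> t) P"
    using ex_primitive_from by blast
  have "0 \<le> t powr \<theta> * \<epsilon> t" if "t0 \<le> t" for t
    using \<epsilon>_pos[OF that] by simp
  from primitive_from_at_top[OF cont P this slow] P show thesis
    using that by blast
qed

text \<open>The trajectory eventually enters each sublevel set \<open>D n\<close> of
  \<open>\<Phi>\<close>. The infima of \<open>U\<close> over these sets converge to
  \<open>U y\<close> for some \<open>y\<close> in their intersection, and such a \<open>y\<close>
  minimizes \<open>\<Phi>\<close>, whence \<open>U p \<le> U y\<close>.\<close>

lemma eventually_U_ge:
  assumes p: "\<Phi> p = \<Phi>min" and min: "\<And>y. \<Phi> y = \<Phi>min \<Longrightarrow> U p \<le> U y"
    and \<Phi>_lim: "((\<lambda>t. \<Phi> (x t)) \<longlongrightarrow> \<Phi>min) at_top" and "\<delta> > 0"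
  shows "\<forall>\<^sub>F t in at_top. U p - \<delta> \<le> U (x t)"
proof -
  define D where "D n = {y. \<Phi> y \<le> \<Phi>min + 1 / real (Suc n)}" for n
  have "decseq D"
    unfolding decseq_Suc_iff
  proof (intro allI subsetI)
    fix n y assume "y \<in> D (Suc n)"
    moreover have "1 / real (Suc (Suc n)) \<le> 1 / real (Suc n)"
      by (intro divide_left_mono) auto
    ultimately show "y \<in> D n" unfolding D_def mem_Collect_eq by linarith
  qed
  moreover have "closed (D n)" "convex (D n)" for n
    unfolding D_def by (intro sublevel_closed_convex \<Phi>_convex continuous_potentials)+
  moreover have "p \<in> D n" for n
    using p by (simp add: D_def)
  ultimately obtain y where y: "\<And>n. y \<in> D n" "(\<lambda>n. Inf (U ` D n)) \<longlonglongrightarrow> U y"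
    using strongly_convex_nested_minima[OF m_pos U_convex continuous_potentials(2) U_bdd, of D p]
    by blast
  have "(\<lambda>n. \<Phi>min + 1 / real (Suc n)) \<longlonglongrightarrow> \<Phi>min + 0"
    by (intro tendsto_intros LIMSEQ_Suc[OF lim_const_over_n])
  then have "\<Phi> y \<le> \<Phi>min"
    using y(1) by (intro LIMSEQ_le_const[of _ "\<Phi>min"]) (auto simp: D_def)
  then have "U p \<le> U y"
    using \<Phi>min_le[of y] by (intro min) simp
  then have "\<forall>\<^sub>F n in sequentially. U p - \<delta> < Inf (U ` D n)"
    using \<open>\<delta> > 0\<close> by (intro order_tendstoD(1)[OF y(2)]) simp
  then obtain n where n: "U p - \<delta> < Inf (U ` D n)"
    using eventually_happens'[OF sequentially_bot] by blast
  have "\<forall>\<^sub>F t in at_top. \<Phi> (x t) < \<Phi>min + 1 / real (Suc n)"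
    by (intro order_tendstoD(2)[OF \<Phi>_lim]) simp
  then show ?thesis
  proof eventually_elim
    case (elim t)
    then have "x t \<in> D n" by (simp add: D_def)
    moreover have "bdd_below (U ` D n)" by (rule bdd_below_mono[OF U_bdd]) auto
    ultimately have "Inf (U ` D n) \<le> U (x t)" by (intro cInf_lower) auto
    then show ?case using n by simp
  qed
qed

section \<open>Assertion (Q1): integrable kinetic term\<close>

proposition convergence_of_slow_trajectory:
  assumes p: "\<Phi> p = \<Phi>min" and min: "\<And>y. \<Phi> y = \<Phi>min \<Longrightarrow> U p \<le> U y"
    and u: "((\<lambda>t. t powr \<theta> * norm (v t)) \<longlongrightarrow> 0) at_top"
    and int: "set_integrable lborel {t0..} (\<lambda>t. t powr \<theta> * (norm (v t))\<^sup>2)"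
  shows "(x \<longlongrightarrow> p) at_top"
proof -
  define f where "f t = t powr \<theta> * (norm (v t))\<^sup>2" for t
  have f_cont: "continuous_on {t0..} f"
    unfolding f_def[abs_def] by (intro continuous_intros continuous_powr continuous_trajectory)
  have f_nonneg: "0 \<le> f t" for t by (simp add: f_def)
  obtain I where I: "primitive_from t0 f I"
    using ex_primitive_from[OF f_cont] by blast
  have DI: "DERIV I t :> f t" if "t0 \<le> t" for t
    using primitive_from_DERIV[OF I that] .
  have "\<exists>B. \<forall>t\<ge>t0. I t \<le> B"
    using set_integrable_iff_primitive_bounded[OF f_cont I f_nonneg] int
    by (simp add: f_def[abs_def])
  then obtain Iinf where Iinf: "(I \<longlongrightarrow> Iinf) at_top"
    using primitive_from_tendsto[OF I f_nonneg] by blast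
  obtain P where P: "primitive_from t0 (\<lambda>t. t powr \<theta> * \<epsilon> t) P" "filterlim P at_top at_top"
    by (rule slow_primitive)
  define e where "e t = t powr \<theta> * \<epsilon> t" for t
  have DP: "DERIV P t :> e t" if "t0 \<le> t" for t
    using primitive_from_DERIV[OF P(1) that] by (simp add: e_def)
  have e_nonneg: "0 \<le> e t" if "t0 \<le> t" for t
    using \<epsilon>_pos[OF that] by (simp add: e_def)
  have E'_f: "E' p t \<le> C * f t - t powr \<theta> * (\<Phi> (x t) - \<Phi>min) - e t * (U (x t) - U p + m * h p t)"
    if "t0 < t" for t
    using E'_le[OF that p] by (simp add: f_def e_def)
  have E'_f': "E' p t \<le> C * f t - e t * (U (x t) - U p + m * h p t)" if "t0 < t" for t
  proof -
    have "0 \<le> t powr \<theta> * (\<Phi> (x t) - \<Phi>min)"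
      using \<Phi>min_le[of "x t"] by simp
    then show ?thesis using E'_f[OF that] by linarith
  qed
  \<comment> \<open>Subtracting \<open>C * I t\<close> removes the kinetic term from the derivative;
    the constant \<open>C * Iinf\<close> makes the total correction vanish at infinity, so that
    \<open>G\<close> is comparable with \<open>Ainf * h p t\<close>.\<close>
  define G where "G t = E p t - C * I t + C * Iinf" for t
  have DG: "DERIV G t :> E' p t - C * f t" if "t0 < t" for t
    unfolding G_def[abs_def] using DI[of t] E_DERIV[OF that] that
    by (auto intro!: derivative_eq_intros)
  have I_err: "((\<lambda>t. C * (Iinf - I t)) \<longlongrightarrow> 0) at_top"
    by (rule tendsto_eq_intros Iinf refl | simp)+
  have ev_u: "\<forall>\<^sub>F t in at_top. t powr \<theta> * norm (v t) < 1"
    using order_tendstoD(2)[OF u, of 1] by simp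
  have ev_I: "\<forall>\<^sub>F t in at_top. \<bar>C * (Iinf - I t)\<bar> < 1"
    using order_tendstoD[OF tendsto_rabs_zero[OF I_err], of 1] by simp
  have ev_A: "\<forall>\<^sub>F t in at_top. Ainf / 2 < A t \<and> A t < Ainf + 1"
    using Ainf_pos by (intro eventually_conj order_tendstoD[OF A_tendsto]) auto

  obtain H where H: "\<forall>\<^sub>F t in at_top. h p t \<le> H"
  proof -
    obtain T where T: "t0 < T" "\<And>t. T \<le> t \<Longrightarrow>
        t powr \<theta> * norm (v t) < 1 \<and> \<bar>C * (Iinf - I t)\<bar> < 1 \<and> Ainf / 2 < A t \<and> A t < Ainf + 1"
      using eventually_conj[OF ev_u eventually_conj[OF ev_I eventually_conj[OF ev_A eventually_gt_at_top[of t0]]]]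
      unfolding eventually_at_top_linorder by (metis linorder_le_cases)
    have cross: "\<bar>E p t - A t * h p t\<bar> \<le> norm (x t - p)" if "T \<le> t" for t
      using E_minus_Ah[of p t] T(2)[OF that]
        mult_right_mono[of "t powr \<theta> * norm (v t)" 1 "norm (x t - p)"] by simp
    \<comment> \<open>\<open>K\<close> is chosen so that \<open>K \<le> h p t\<close> gives
      \<open>1 \<le> U (x t) - U p + m * h p t\<close>, using only the lower bound of
      \<open>U\<close>. Reaching the level \<open>M\<close> forces \<open>K \<le> h p t\<close>,
      because |x - p| is at most 1/2 + h and the correction by \<open>I\<close> is below 1.\<close>
    define K where "K = (U p - Umin + 1) / m"
    define M where "M = (Ainf + 2) * K + 2"
    have "\<forall>\<^sub>F t in at_top. G t \<le> M"
    proof (rule eventually_le_if_decreasing_above[of T G _ P e])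
      fix t assume t: "T \<le> t"
      then show "DERIV G t :> E' p t - C * f t" "DERIV P t :> e t" "0 \<le> e t"
        using DG DP e_nonneg T(1) by simp_all
      assume "M \<le> G t"
      have "norm (x t - p) \<le> 1 / 2 + h p t"
        using zero_le_power2[of "norm (x t - p) - 1"] by (simp add: h_def power2_diff)
      moreover have "A t * h p t \<le> (Ainf + 1) * h p t"
        using T(2)[OF t] h_nonneg by (intro mult_right_mono) auto
      ultimately have "G t \<le> (Ainf + 2) * h p t + 2"
        using cross[OF t] T(2)[OF t] unfolding G_def abs_le_iff abs_less_iff
        by (simp add: algebra_simps)
      with \<open>M \<le> G t\<close> have "(Ainf + 2) * K \<le> (Ainf + 2) * h p t"
        by (simp add: M_def)
      then have "K \<le> h p t"
        using Ainf_pos by (simp add: mult_le_cancel_left_pos)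
      then have "U p - Umin + 1 \<le> m * h p t"
        using m_pos by (simp add: K_def pos_divide_le_eq mult.commute)
      then have "1 \<le> U (x t) - U p + m * h p t"
        using Umin_le[of "x t"] by simp
      from mult_left_mono[OF this e_nonneg[of t]]
      show "E' p t - C * f t \<le> - e t"
        using E'_f'[of t] T(1) t by simp
    qed (rule P(2))
    then have "\<forall>\<^sub>F t in at_top. h p t \<le> 4 / Ainf * (M + 1 + 2 / Ainf)"
      using eventually_ge_at_top[of T]
    proof eventually_elim
      case (elim t)
      have "E p t \<le> M + 1"
        using elim T(2)[of t] by (simp add: G_def algebra_simps abs_less_iff)
      \<comment> \<open>Young's inequality with weights such that half of the lower bound
        \<open>Ainf / 2 * h p t\<close> survives the cross term.\<close>
      moreover have "norm (x t - p) \<le> Ainf / 4 * h p t + 2 / Ainf"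
      proof -
        have "0 \<le> Ainf / 8 * (norm (x t - p) - 4 / Ainf)\<^sup>2"
          using Ainf_pos by simp
        also have "\<dots> = Ainf / 4 * h p t + 2 / Ainf - norm (x t - p)"
          using Ainf_pos by (simp add: h_def power2_eq_square field_simps)
        finally show ?thesis by simp
      qed
      moreover have "Ainf / 2 * h p t \<le> A t * h p t"
        using T(2)[of t] elim h_nonneg by (intro mult_right_mono) auto
      ultimately have "Ainf / 4 * h p t \<le> M + 1 + 2 / Ainf"
        using cross[of t] elim by simp
      from mult_left_mono[OF this, of "4 / Ainf"] show ?case
        using Ainf_pos by simp
    qed
    then show thesis by (rule that)
  qed

  have "((\<lambda>t. (A t - Ainf) * h p t) \<longlongrightarrow> 0) at_top"
  proof (rule Lim_null_comparison)
    show "\<forall>\<^sub>F t in at_top. norm ((A t - Ainf) * h p t) \<le> \<bar>A t - Ainf\<bar> * H"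
      using H by eventually_elim (auto simp: abs_mult h_nonneg intro!: mult_left_mono)
    show "((\<lambda>t. \<bar>A t - Ainf\<bar> * H) \<longlongrightarrow> 0) at_top"
      using tendsto_mult_right[OF tendsto_rabs_zero[OF LIM_zero[OF A_tendsto]], of H] by simp
  qed
  from tendsto_add[OF tendsto_add[OF this cross_term_tendsto_0[OF u H]] I_err]
  have gap: "((\<lambda>t. G t - Ainf * h p t) \<longlongrightarrow> 0) at_top"
    by (simp add: G_def algebra_simps)

  obtain L where L: "(W \<longlongrightarrow> L) at_top" "\<And>t. t0 + 1 \<le> t \<Longrightarrow> L \<le> W t"
  proof -
    have "W t \<le> W s" if "t0 + 1 \<le> s" "s \<le> t" for s t
    proof -
      \<comment> \<open>Exponent 0 with a zero majorant: only the dissipation remains in the formal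
        rate.\<close>
      have "t powr 0 * W t - 0 \<le> s powr 0 * W s - 0"
        using that \<alpha>_pos
        by (intro weighted_energy_decreasing[where j = "\<lambda>_. 0"]) auto
      then show ?thesis using that t0_pos by simp
    qed
    then have "\<exists>L. (W \<longlongrightarrow> L) at_top \<and> (\<forall>t\<ge>t0 + 1. L \<le> W t)"
      using W_nonneg by (intro tendsto_at_top_if_antimono_bounded_below[where B = 0]) auto
    then show thesis using that by blast
  qed
  have "L \<le> 0"
  proof (rule ccontr)
    assume "\<not> L \<le> 0"
    then have "L > 0" by simp
    have "((\<lambda>t. \<epsilon> t * (U p - Umin)) \<longlongrightarrow> 0) at_top"
      using tendsto_mult_right[OF \<epsilon>_lim, of "U p - Umin"] by simp
    then have "\<forall>\<^sub>F t in at_top. \<epsilon> t * (U p - Umin) < L / 2"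
      using \<open>L > 0\<close> by (intro order_tendstoD) auto
    then obtain T where T: "t0 + 1 \<le> T" "\<And>t. T \<le> t \<Longrightarrow> \<epsilon> t * (U p - Umin) < L / 2"
      using eventually_ge_at_top[of "t0 + 1"] unfolding eventually_at_top_linorder
      by (metis linorder_le_cases order_trans)
    \<comment> \<open>The additional 1/2 supplies the kinetic part needed to complete the potential
      gaps to \<open>W\<close>, so the derivative is at most -(L/2) t^\<theta>. The level
      \<open>\<beta>\<close> lies below every value compatible with
      \<open>- 1 < E p t - A t * h p t\<close> and \<open>I t < Iinf + 1\<close>.\<close>
    define G2 where "G2 t = E p t - (C + 1 / 2) * I t" for t
    define \<beta> where "\<beta> = - 1 - (C + 1 / 2) * (Iinf + 1)"
    \<comment> \<open>From time 1 on, t^\<theta> is at least 1 and the rate is at least the constant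
      L/2.\<close>
    define T1 where "T1 = max T 1"
    have "\<forall>\<^sub>F t in at_top. G2 t \<le> \<beta>"
    proof (rule eventually_le_if_decreasing_above[of T1 G2 _ "\<lambda>t. L / 2 * t" "\<lambda>_. L / 2"])
      fix t assume "T1 \<le> t"
      then have t: "t0 < t" "1 \<le> t" "T \<le> t" "t0 + 1 \<le> t" using T(1) by (auto simp: T1_def)
      show "DERIV G2 t :> E' p t - (C + 1 / 2) * f t"
        unfolding G2_def[abs_def] using DI[of t] E_DERIV[OF t(1)] t(1)
        by (auto intro!: derivative_eq_intros)
      show "DERIV (\<lambda>t. L / 2 * t) t :> L / 2"
        by (auto intro!: derivative_eq_intros)
      show "0 \<le> L / 2" using \<open>L > 0\<close> by simp
      have "\<Phi> (x t) - \<Phi>min + \<epsilon> t * (U (x t) - U p + m * h p t)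
          = W t - (norm (v t))\<^sup>2 / 2 - \<epsilon> t * (U p - Umin) + \<epsilon> t * m * h p t"
        by (simp add: energy_def algebra_simps)
      also have "\<dots> \<ge> L / 2 - (norm (v t))\<^sup>2 / 2"
        using L(2)[OF t(4)] T(2)[OF t(3)] \<epsilon>_pos[of t] t(1) m_pos
          mult_nonneg_nonneg[OF mult_nonneg_nonneg[of "\<epsilon> t" m] h_nonneg[of p t]] by simp
      finally have "t powr \<theta> * (L / 2 - (norm (v t))\<^sup>2 / 2)
          \<le> t powr \<theta> * (\<Phi> (x t) - \<Phi>min + \<epsilon> t * (U (x t) - U p + m * h p t))"
        by (intro mult_left_mono) auto
      moreover have "L / 2 \<le> t powr \<theta> * (L / 2)"
        using ge_one_powr_ge_zero[OF t(2) \<theta>(1)] \<open>L > 0\<close> by simp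
      ultimately show "E' p t - (C + 1 / 2) * f t \<le> - (L / 2)"
        using E'_f[OF t(1)] by (simp add: f_def e_def algebra_simps)
    qed (rule filterlim_tendsto_pos_mult_at_top[OF tendsto_const _ filterlim_ident],
        use \<open>L > 0\<close> in simp)
    moreover have "\<forall>\<^sub>F t in at_top. E p t - A t * h p t > - 1"
      using order_tendstoD(1)[OF cross_term_tendsto_0[OF u H], of "-1"] by simp
    moreover have "\<forall>\<^sub>F t in at_top. I t < Iinf + 1"
      using order_tendstoD(2)[OF Iinf] by simp
    ultimately have "\<forall>\<^sub>F t in at_top. G2 t \<le> \<beta> \<and> - 1 < E p t - A t * h p t \<and> I t < Iinf + 1 \<and> Ainf / 2 < A t"
      using ev_A by eventually_elim simp
    then obtain t where t: "G2 t \<le> \<beta>" "- 1 < E p t - A t * h p t" "I t < Iinf + 1" "Ainf / 2 < A t"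
      using eventually_happens'[OF trivial_limit_at_top_linorder] by blast
    have "0 \<le> A t * h p t" using t(4) Ainf_pos h_nonneg by (intro mult_nonneg_nonneg) auto
    moreover have "(C + 1 / 2) * I t \<le> (C + 1 / 2) * (Iinf + 1)"
      using t(3) C_ge_1 by (intro mult_left_mono) auto
    ultimately show False
      using t(1,2) unfolding G2_def \<beta>_def by linarith
  qed
  moreover have "0 \<le> L"
    using tendsto_lowerbound[OF L(1), of 0] W_nonneg
    by (auto simp: eventually_at_top_linorder)
  ultimately have W_lim: "(W \<longlongrightarrow> 0) at_top" using L(1) by simp
  have "((\<lambda>t. \<Phi> (x t) - \<Phi>min) \<longlongrightarrow> 0) at_top"
  proof (rule Lim_null_comparison[OF _ W_lim])
    show "\<forall>\<^sub>F t in at_top. norm (\<Phi> (x t) - \<Phi>min) \<le> W t"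
      using eventually_ge_at_top[of t0] by eventually_elim (simp add: \<Phi>min_le \<Phi>_le_W)
  qed
  then have \<Phi>_lim: "((\<lambda>t. \<Phi> (x t)) \<longlongrightarrow> \<Phi>min) at_top"
    by (simp add: LIM_zero_iff)

  have "(h p \<longlongrightarrow> 0) at_top"
  proof (rule order_tendstoI)
    fix c :: real assume "c < 0"
    then show "\<forall>\<^sub>F t in at_top. c < h p t"
      by (intro always_eventually allI) (rule less_le_trans[OF _ h_nonneg])
  next
    fix c :: real assume "0 < c"
    \<comment> \<open>Above the level \<open>\<beta>\<close>, the gap bound
      \<open>\<beta> / 2\<close> leaves \<open>2 * \<delta> \<le> m * h p t\<close>, and one
      \<open>\<delta>\<close> is spent on the lower bound for \<open>U (x t)\<close>. Below it,
      \<open>Ainf * h p t\<close> is less than 3/2 of \<open>\<beta>\<close>, hence less than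
      \<open>Ainf * c\<close>.\<close>
    define \<beta> where "\<beta> = Ainf * c / 2"
    define \<delta> where "\<delta> = m * \<beta> / (4 * Ainf)"
    have "\<beta> > 0" "\<delta> > 0" using \<open>0 < c\<close> Ainf_pos m_pos by (simp_all add: \<beta>_def \<delta>_def)
    have ev_gap: "\<forall>\<^sub>F t in at_top. \<bar>G t - Ainf * h p t\<bar> < \<beta> / 2"
      using order_tendstoD(2)[OF tendsto_rabs_zero[OF gap], of "\<beta> / 2"] \<open>\<beta> > 0\<close> by simp
    obtain T where T: "\<And>t. T \<le> t \<Longrightarrow>
        \<bar>G t - Ainf * h p t\<bar> < \<beta> / 2 \<and> U p - \<delta> \<le> U (x t) \<and> t0 < t"
      using eventually_conj[OF ev_gap eventually_conj[OF eventually_U_ge[OF p min \<Phi>_lim \<open>\<delta> > 0\<close>]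
            eventually_gt_at_top[of t0]]]
      unfolding eventually_at_top_linorder by blast
    have "\<forall>\<^sub>F t in at_top. G t \<le> \<beta>"
    proof (rule eventually_le_if_decreasing_above[of T G _ "\<lambda>t. \<delta> * P t" "\<lambda>t. \<delta> * e t"])
      fix t assume "T \<le> t"
      note t = T[OF this]
      show "DERIV G t :> E' p t - C * f t" using DG t by simp
      show "DERIV (\<lambda>t. \<delta> * P t) t :> \<delta> * e t" using DP[of t] t by (intro DERIV_cmult) simp
      show "0 \<le> \<delta> * e t" using \<open>\<delta> > 0\<close> e_nonneg[of t] t by simp
      assume "\<beta> \<le> G t"
      then have "\<beta> / 2 \<le> Ainf * h p t" using t by linarith
      from mult_left_mono[OF this, of "m / Ainf"] have "2 * \<delta> \<le> m * h p t"
        using m_pos Ainf_pos by (simp add: \<delta>_def mult.commute)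
      then have "\<delta> \<le> U (x t) - U p + m * h p t" using t by linarith
      from mult_left_mono[OF this e_nonneg[of t]]
      show "E' p t - C * f t \<le> - (\<delta> * e t)"
        using E'_f'[of t] t by (simp add: mult.commute)
    qed (use \<open>\<delta> > 0\<close> P(2) in \<open>auto intro!: filterlim_tendsto_pos_mult_at_top[OF tendsto_const]\<close>)
    with ev_gap show "\<forall>\<^sub>F t in at_top. h p t < c"
    proof eventually_elim
      case (elim t)
      then have "Ainf * h p t < Ainf * c" using \<open>\<beta> > 0\<close> unfolding \<beta>_def by linarith
      then show ?case using Ainf_pos by simp
    qed
  qed
  then show ?thesis by (rule tendsto_if_h_tendsto_0)
qed

section \<open>Assertion (Q2): a Lyapunov function when p also minimizes U globally\<close>

proposition convergence_to_global_minimizer: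
  assumes p: "\<Phi> p = \<Phi>min" and Up: "U p = Umin"
  shows "(x \<longlongrightarrow> p) at_top"
    and "((\<lambda>t. t powr (1 + \<theta>) * W t) \<longlongrightarrow> 0) at_top"
    and "set_integrable lborel {t0..} (\<lambda>t. t powr \<theta> * W t)"
proof -
  \<comment> \<open>For \<theta> = 1 this is the midpoint of the admissible interval from 3/(2
    \<alpha>) to 1/2. For \<theta> < 1 the bound on c (1 + \<theta>) is the only restriction, the
    other demands holding for large t.\<close>
  define c where "c = (if \<theta> = 1 then 3 / (4 * \<alpha>) + 1 / 4 else 1 / 2)"
  have "c > 0" using \<alpha>_pos by (auto simp: c_def intro!: add_pos_pos)
  have c1: "c * (1 + \<theta>) < 1"
    using \<alpha>(2) \<theta> by (auto simp: c_def field_simps)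
  have c3: "1 < c * Ainf" if "\<theta> = 1"
  proof -
    have "3 / 2 < c * \<alpha>" using \<alpha>(2)[OF that] \<alpha>_pos that by (simp add: c_def field_simps)
    then show ?thesis using c1 that unfolding Ainf_def by (simp add: algebra_simps)
  qed
  have c2: "\<forall>\<^sub>F t in at_top. (C + 1 / 2) * t powr \<theta> \<le> c * \<alpha> * t"
  proof (cases "\<theta> = 1")
    case True
    then have "3 / 2 < c * \<alpha>" using \<alpha>(2) \<alpha>_pos by (simp add: c_def field_simps)
    have "C = 1" using True unfolding C_def by simp
    show ?thesis
      using eventually_gt_at_top[of 0]
    proof eventually_elim
      case (elim t)
      then show ?case
        unfolding \<open>C = 1\<close>
        using mult_right_mono[of "3 / 2" "c * \<alpha>" t] \<open>3 / 2 < c * \<alpha>\<close> by (simp add: True)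
    qed
  next
    case False
    then have "((\<lambda>t. (C + 1 / 2) * t powr (\<theta> - 1)) \<longlongrightarrow> (C + 1 / 2) * 0) at_top"
      using \<theta> by (intro tendsto_intros powr_neg_tendsto) auto
    then have "\<forall>\<^sub>F t in at_top. (C + 1 / 2) * t powr (\<theta> - 1) < c * \<alpha>"
      using \<open>c > 0\<close> \<alpha>_pos by (intro order_tendstoD(2)) auto
    then show ?thesis
      using eventually_gt_at_top[of 0]
    proof eventually_elim
      case (elim t)
      then have "(C + 1 / 2) * t powr (\<theta> - 1) * t \<le> c * \<alpha> * t"
        by (intro mult_right_mono) auto
      moreover have "t powr (\<theta> - 1) * t = t powr \<theta>"
        using elim by (simp add: powr_diff)
      ultimately show ?case by (simp add: mult.assoc)
    qed
  qed

  define V where "V t = c * (t powr (1 + \<theta>) * W t) + E p t" for t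
  have V_ge: "(A t - t powr (\<theta> - 1) / c) * h p t \<le> V t" if "t0 \<le> t" for t
  proof -
    have "t > 0" using that t0_pos by simp
    define y where "y = t powr \<theta>"
    have y: "y > 0" "t powr (\<theta> - 1) = y / t" "t powr (1 + \<theta>) = t * y"
      using \<open>t > 0\<close> by (simp_all add: y_def powr_diff powr_add)
    \<comment> \<open>The square trades the cross term of \<open>E\<close> for the kinetic part of
      \<open>c * (t powr (1 + \<theta>) * W t)\<close>, at the price of t^(\<theta> - 1)/c times
      \<open>h\<close>.\<close>
    have "0 \<le> y / (2 * c * t) * (c * t * norm (v t) - norm (x t - p))\<^sup>2"
      using y \<open>c > 0\<close> \<open>t > 0\<close> by simp
    also have "\<dots> = c * (t * y * ((norm (v t))\<^sup>2 / 2)) - y * norm (v t) * norm (x t - p) + y / t / c * h p t"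
      using \<open>c > 0\<close> \<open>t > 0\<close> by (simp add: h_def power2_eq_square field_simps)
    also have "c * (t * y * ((norm (v t))\<^sup>2 / 2)) \<le> c * (t * y * W t)"
      using kinetic_le_W[OF that] \<open>c > 0\<close> \<open>t > 0\<close> y by (intro mult_left_mono) auto
    finally show ?thesis
      using E_minus_Ah[of p t] unfolding V_def y(2,3) y_def[symmetric] by (simp add: left_diff_distrib)
  qed
  obtain \<kappa> where "\<kappa> > 0" and \<kappa>: "\<forall>\<^sub>F t in at_top. \<kappa> * h p t \<le> V t"
  proof -
    define B where "B = (if \<theta> = 1 then Ainf - 1 / c else Ainf)"
    have "B > 0"
      using c3 Ainf_pos \<open>c > 0\<close> by (auto simp: B_def field_simps)
    have "((\<lambda>t. A t - t powr (\<theta> - 1) / c) \<longlongrightarrow> B) at_top"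
    proof (cases "\<theta> = 1")
      case True
      have "((\<lambda>t. t powr (\<theta> - 1)) \<longlongrightarrow> 1) at_top"
        by (rule Lim_transform_eventually[OF tendsto_const])
          (use eventually_gt_at_top[of 0] True in \<open>auto elim!: eventually_mono\<close>)
      then have "((\<lambda>t. A t - t powr (\<theta> - 1) / c) \<longlongrightarrow> Ainf - 1 / c) at_top"
        using \<open>c > 0\<close> by (intro tendsto_intros A_tendsto) auto
      then show ?thesis using True by (simp add: B_def)
    next
      case False
      then have "((\<lambda>t. A t - t powr (\<theta> - 1) / c) \<longlongrightarrow> Ainf - 0 / c) at_top"
        using \<open>c > 0\<close> \<theta> by (intro tendsto_intros A_tendsto powr_neg_tendsto) auto
      then show ?thesis using False by (simp add: B_def)
    qed
    then have "\<forall>\<^sub>F t in at_top. B / 2 < A t - t powr (\<theta> - 1) / c"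
      using \<open>B > 0\<close> by (intro order_tendstoD(1)) auto
    then have "\<forall>\<^sub>F t in at_top. B / 2 * h p t \<le> V t"
      using eventually_ge_at_top[of t0]
    proof eventually_elim
      case (elim t)
      then have "B / 2 * h p t \<le> (A t - t powr (\<theta> - 1) / c) * h p t"
        using h_nonneg by (intro mult_right_mono) auto
      then show ?case using V_ge[OF elim(2)] by (rule order_trans)
    qed
    then show thesis using that[of "B / 2"] \<open>B > 0\<close> by simp
  qed

  define f where "f t = t powr \<theta> * W t" for t
  have f_cont: "continuous_on {t0..} f"
    unfolding f_def[abs_def] by (intro continuous_intros continuous_powr continuous_W)
  have f_nonneg: "0 \<le> f t" if "t0 \<le> t" for t using W_nonneg[OF that] by (simp add: f_def)
  obtain Q where Q: "primitive_from t0 f Q"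
    using ex_primitive_from[OF f_cont] by blast
  have DQ: "DERIV Q t :> f t" if "t0 \<le> t" for t
    using primitive_from_DERIV[OF Q that] .
  obtain P where P: "primitive_from t0 (\<lambda>t. t powr \<theta> * \<epsilon> t) P" "filterlim P at_top at_top"
    by (rule slow_primitive)
  define e where "e t = t powr \<theta> * \<epsilon> t" for t
  have DP: "DERIV P t :> e t" if "t0 \<le> t" for t
    using primitive_from_DERIV[OF P(1) that] by (simp add: e_def)
  have e_nonneg: "0 \<le> e t" if "t0 \<le> t" for t
    using \<epsilon>_pos[OF that] by (simp add: e_def)
  define g where "g t = e t * h p t" for t
  have g_cont: "continuous_on {t0..} g"
    unfolding g_def[abs_def] e_def h_def
    by (intro continuous_intros continuous_powr continuous_trajectory \<epsilon>_cont) simp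
  have g_nonneg: "0 \<le> g t" if "t0 \<le> t" for t
    using e_nonneg[OF that] h_nonneg[of p t] by (simp add: g_def)
  obtain R where R: "primitive_from t0 g R"
    using ex_primitive_from[OF g_cont] by blast
  have DR: "DERIV R t :> g t" if "t0 \<le> t" for t
    using primitive_from_DERIV[OF R that] .

  \<comment> \<open>What remains of the decrease -t^\<theta> W of \<open>E\<close> after the growth
    c (1 + \<theta>) t^\<theta> W caused by the weight.\<close>
  define k where "k = 1 - c * (1 + \<theta>)"
  have "k > 0" using c1 by (simp add: k_def)
  obtain T where T: "t0 < T" "1 \<le> T" "\<And>t. T \<le> t \<Longrightarrow> (C + 1 / 2) * t powr \<theta> \<le> c * \<alpha> * t"
    "\<And>t. T \<le> t \<Longrightarrow> \<kappa> * h p t \<le> V t"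
  proof -
    obtain T where "\<And>t. T \<le> t \<Longrightarrow> (C + 1 / 2) * t powr \<theta> \<le> c * \<alpha> * t \<and> \<kappa> * h p t \<le> V t"
      using eventually_conj[OF c2 \<kappa>] unfolding eventually_at_top_linorder by blast
    then show thesis using that[of "max T (max 1 (t0 + 1))"] by simp
  qed
  have lyapunov: "V b + k * Q b + m * R b \<le> V a + k * Q a + m * R a" if ab: "T \<le> a" "a \<le> b" for a b
  proof -
    \<comment> \<open>Chosen so that t^(1 + \<theta>) W - J is the Lyapunov quantity divided by
      \<open>c\<close>.\<close>
    define J where "J t = - (E p t + k * Q t + m * R t) / c" for t
    define j where "j t = - (E' p t + k * f t + m * g t) / c" for t
    have "b powr (1 + \<theta>) * W b - J b \<le> a powr (1 + \<theta>) * W a - J a"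
    proof (rule weighted_energy_decreasing)
      show "t0 < a" "a \<le> b" using ab T by auto
      fix s assume "a \<le> s" "s \<le> b"
      then have s: "T \<le> s" "t0 < s" "t0 \<le> s" "0 < s" using ab T by auto
      show "DERIV J s :> j s"
        unfolding J_def[abs_def] j_def
        by (intro DERIV_cdivide DERIV_minus DERIV_add DERIV_cmult E_DERIV DQ DR s)
      \<comment> \<open>Because \<open>U p = Umin\<close>, the potential gaps in the bound for
        \<open>E'\<close> are exactly those in \<open>W\<close>; only half the squared speed has to
        be added.\<close>
      have "E' p s \<le> (C + 1 / 2) * s powr \<theta> * (norm (v s))\<^sup>2 - f s - m * g s"
        using E'_le[OF s(2) p] unfolding f_def g_def e_def energy_def Up
        by (simp add: algebra_simps)
      also have "(C + 1 / 2) * s powr \<theta> * (norm (v s))\<^sup>2 \<le> c * \<alpha> * s * (norm (v s))\<^sup>2"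
        using T(3)[OF s(1)] by (intro mult_right_mono) auto
      finally have "c * ((1 + \<theta>) * f s - \<alpha> * s * (norm (v s))\<^sup>2) \<le> - (E' p s + k * f s + m * g s)"
        by (simp add: k_def algebra_simps)
      also have "\<dots> = c * j s"
        using \<open>c > 0\<close> by (simp add: j_def)
      finally have "c * ((1 + \<theta>) * f s - \<alpha> * s * (norm (v s))\<^sup>2) \<le> c * j s" .
      then show "(1 + \<theta>) * s powr (1 + \<theta> - 1) * W s - \<alpha> * s powr (1 + \<theta> - \<theta>) * (norm (v s))\<^sup>2 \<le> j s"
        using \<open>c > 0\<close> s by (simp add: f_def mult.assoc)
    qed
    from mult_left_mono[OF this less_imp_le[OF \<open>c > 0\<close>]]
    have "c * (b powr (1 + \<theta>) * W b) - c * J b \<le> c * (a powr (1 + \<theta>) * W a) - c * J a"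
      by (simp only: right_diff_distrib)
    moreover have "c * J t = - (E p t + k * Q t + m * R t)" for t
      using \<open>c > 0\<close> by (simp add: J_def)
    ultimately show ?thesis by (simp add: V_def)
  qed
  have V_nonneg: "0 \<le> V t" if "T \<le> t" for t
    using T(4)[OF that] mult_nonneg_nonneg[OF less_imp_le[OF \<open>\<kappa> > 0\<close>] h_nonneg[of p t]] by simp
  have Q_mono: "Q s \<le> Q t" and R_mono: "R s \<le> R t" if "s \<le> t" for s t
    using primitive_from_mono[OF Q f_nonneg that] primitive_from_mono[OF R g_nonneg that] by auto
  have V_anti: "V b \<le> V a" if "T \<le> a" "a \<le> b" for a b
    using lyapunov[OF that] mult_left_mono[OF Q_mono[OF that(2)], of k] mult_left_mono[OF R_mono[OF that(2)], of m]
      \<open>k > 0\<close> m_pos by linarith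
  have Q_bound: "Q t \<le> Q T + V T / k" and R_bound: "R t \<le> R T + V T / m" for t
  proof -
    define s where "s = max t T"
    have "k * Q s + m * R s \<le> V T + k * Q T + m * R T"
      using lyapunov[of T s] V_nonneg[of s] by (simp add: s_def)
    moreover have "k * Q T \<le> k * Q s" "k * Q t \<le> k * Q s"
      using Q_mono \<open>k > 0\<close> by (auto simp: s_def)
    moreover have "m * R T \<le> m * R s" "m * R t \<le> m * R s"
      using R_mono m_pos by (auto simp: s_def)
    ultimately have "k * Q t \<le> k * Q T + V T" "m * R t \<le> m * R T + V T"
      by linarith+
    then show "Q t \<le> Q T + V T / k" "R t \<le> R T + V T / m"
      using \<open>k > 0\<close> m_pos by (simp_all add: field_simps)
  qed
  show int: "set_integrable lborel {t0..} (\<lambda>t. t powr \<theta> * W t)"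
    using set_integrable_iff_primitive_bounded[OF f_cont Q f_nonneg] Q_bound
    by (auto simp: f_def[abs_def])

  obtain Qinf where Qinf: "(Q \<longlongrightarrow> Qinf) at_top"
    using primitive_from_tendsto[OF Q f_nonneg Q_bound] by blast
  obtain l where l: "((\<lambda>t. t powr (1 + \<theta>) * W t) \<longlongrightarrow> l) at_top"
  proof -
    \<comment> \<open>Dropping the dissipation leaves the rate (1 + \<theta>) t^\<theta> W, already
      known to be integrable. Hence \<open>Z\<close> is nonincreasing and bounded below, and the
      weighted energy has a limit.\<close>
    define Z where "Z t = t powr (1 + \<theta>) * W t - (1 + \<theta>) * Q t" for t
    have "Z b \<le> Z a" if ab: "T \<le> a" "a \<le> b" for a b
      unfolding Z_def
    proof (rule weighted_energy_decreasing[where j = "\<lambda>t. (1 + \<theta>) * f t"])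
      show "t0 < a" "a \<le> b" using ab T by auto
      fix s assume "a \<le> s"
      then have s: "t0 \<le> s" "0 < s" using ab T by auto
      show "DERIV (\<lambda>t. (1 + \<theta>) * Q t) s :> (1 + \<theta>) * f s"
        by (intro DERIV_cmult DQ s)
      show "(1 + \<theta>) * s powr (1 + \<theta> - 1) * W s - \<alpha> * s powr (1 + \<theta> - \<theta>) * (norm (v s))\<^sup>2
          \<le> (1 + \<theta>) * f s"
        using \<alpha>_pos s by (simp add: f_def)
    qed
    moreover have "- (1 + \<theta>) * (Q T + V T / k) \<le> Z t" if "T \<le> t" for t
    proof -
      have "0 \<le> t powr (1 + \<theta>) * W t" using W_nonneg[of t] that T by simp
      moreover have "(1 + \<theta>) * Q t \<le> (1 + \<theta>) * (Q T + V T / k)"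
        using Q_bound \<theta> by (intro mult_left_mono) auto
      ultimately show ?thesis unfolding Z_def by linarith
    qed
    ultimately obtain z where "(Z \<longlongrightarrow> z) at_top"
      using tendsto_at_top_if_antimono_bounded_below[of T Z] by blast
    from tendsto_add[OF this tendsto_mult_left[OF Qinf, of "1 + \<theta>"]] show thesis
      by (intro that) (simp add: Z_def)
  qed
  have "l \<le> 0"
  proof (rule ccontr)
    assume "\<not> l \<le> 0"
    then have "\<forall>\<^sub>F t in at_top. l / 2 < t powr (1 + \<theta>) * W t"
      by (intro order_tendstoD(1)[OF l]) simp
    then obtain T' where T': "\<And>t. T' \<le> t \<Longrightarrow> l / 2 < t powr (1 + \<theta>) * W t"
      unfolding eventually_at_top_linorder by blast
    have "\<forall>\<^sub>F t in at_top. - Q t \<le> - (Q T + V T / k) - 1"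
    \<comment> \<open>A positive limit would make t^\<theta> W at least l/(2 t), so \<open>Q\<close>
      would grow like a logarithm.\<close>
    proof (rule eventually_le_if_decreasing_above[of "max T T'" _ _ "\<lambda>t. l / 2 * ln t" "\<lambda>t. l / 2 * (1 / t)"])
      fix t assume "max T T' \<le> t"
      then have t: "t0 \<le> t" "0 < t" "T' \<le> t" using T by auto
      show "DERIV (\<lambda>t. - Q t) t :> - f t" by (intro DERIV_minus DQ t)
      show "DERIV (\<lambda>t. l / 2 * ln t) t :> l / 2 * (1 / t)"
        using t by (intro DERIV_cmult DERIV_ln_divide)
      show "0 \<le> l / 2 * (1 / t)" using \<open>\<not> l \<le> 0\<close> t by simp
      have "l / 2 < t * f t" using T'[OF t(3)] t by (simp add: f_def powr_add mult.assoc)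
      then show "- f t \<le> - (l / 2 * (1 / t))" using t by (simp add: field_simps)
    qed (rule filterlim_tendsto_pos_mult_at_top[OF tendsto_const _ ln_at_top],
        use \<open>\<not> l \<le> 0\<close> in simp)
    then obtain t where "- Q t \<le> - (Q T + V T / k) - 1"
      using eventually_happens'[OF trivial_limit_at_top_linorder] by blast
    then show False using Q_bound[of t] by simp
  qed
  moreover have "0 \<le> l"
    using W_nonneg by (intro tendsto_lowerbound[OF l] eventually_at_top_linorderI[of t0]) auto
  ultimately show W_lim: "((\<lambda>t. t powr (1 + \<theta>) * W t) \<longlongrightarrow> 0) at_top"
    using l by simp

  have u: "((\<lambda>t. t powr \<theta> * norm (v t)) \<longlongrightarrow> 0) at_top"
  proof (rule Lim_null_comparison)
    have "((\<lambda>t. sqrt (2 * (t powr (1 + \<theta>) * W t))) \<longlongrightarrow> sqrt (2 * 0)) at_top"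
      by (intro tendsto_intros W_lim)
    then show "((\<lambda>t. sqrt (2 * (t powr (1 + \<theta>) * W t))) \<longlongrightarrow> 0) at_top" by simp
    show "\<forall>\<^sub>F t in at_top. norm (t powr \<theta> * norm (v t)) \<le> sqrt (2 * (t powr (1 + \<theta>) * W t))"
      using eventually_ge_at_top[of T]
    proof eventually_elim
      case (elim t)
      then have t: "t0 \<le> t" "1 \<le> t" using T by auto
      have "(t powr \<theta> * norm (v t))\<^sup>2 = t powr (\<theta> + \<theta>) * (norm (v t))\<^sup>2"
        unfolding power_mult_distrib power2_eq_square powr_add by simp
      \<comment> \<open>Raising the exponent from 2 \<theta> to 1 + \<theta> uses \<theta> \<le> 1
        and t \<ge> 1.\<close>
      also have "\<dots> \<le> t powr (1 + \<theta>) * (2 * W t)"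
        using kinetic_le_W[OF t(1)] t \<theta> by (intro mult_mono powr_mono) auto
      finally have "t powr \<theta> * norm (v t) \<le> sqrt (2 * (t powr (1 + \<theta>) * W t))"
        by (intro real_le_rsqrt) simp
      then show ?case by simp
    qed
  qed
  have H: "\<forall>\<^sub>F t in at_top. h p t \<le> V T / \<kappa>"
    using eventually_ge_at_top[of T]
  proof eventually_elim
    case (elim t)
    then have "\<kappa> * h p t \<le> V T" using T(4)[of t] V_anti[of T t] by simp
    then show ?case using \<open>\<kappa> > 0\<close> by (simp add: field_simps)
  qed
  obtain VL where VL: "(V \<longlongrightarrow> VL) at_top"
    using tendsto_at_top_if_antimono_bounded_below[of T V 0] V_anti V_nonneg by blast
  define hl where "hl = VL / Ainf"
  have h_lim: "(h p \<longlongrightarrow> hl) at_top"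
  proof -
    \<comment> \<open>The numerator is \<open>A t * h p t\<close>, and all its parts have limits; so
      \<open>h\<close> converges, and only the value of the limit is still open.\<close>
    have "((\<lambda>t. (V t - c * (t powr (1 + \<theta>) * W t) - (E p t - A t * h p t)) / A t)
        \<longlongrightarrow> (VL - c * 0 - 0) / Ainf) at_top"
      using Ainf_pos by (intro tendsto_intros VL W_lim cross_term_tendsto_0[OF u H] A_tendsto) simp
    then have "((\<lambda>t. A t * h p t / A t) \<longlongrightarrow> hl) at_top"
      by (simp add: V_def hl_def)
    moreover have "\<forall>\<^sub>F t in at_top. A t * h p t / A t = h p t"
      using order_tendstoD(1)[OF A_tendsto Ainf_pos] by eventually_elim simp
    ultimately show ?thesis by (rule Lim_transform_eventually)
  qed
  have "hl \<le> 0"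
  proof (rule ccontr)
    assume "\<not> hl \<le> 0"
    then have "\<forall>\<^sub>F t in at_top. hl / 2 < h p t"
      by (intro order_tendstoD(1)[OF h_lim]) simp
    then obtain T' where T': "\<And>t. T' \<le> t \<Longrightarrow> hl / 2 < h p t"
      unfolding eventually_at_top_linorder by blast
    have "\<forall>\<^sub>F t in at_top. - R t \<le> - (R T + V T / m) - 1"
    \<comment> \<open>A positive limit would make \<open>R\<close> grow at least like a multiple of
      the divergent \<open>P\<close>, against its bound.\<close>
    proof (rule eventually_le_if_decreasing_above[of "max T T'" _ _ "\<lambda>t. hl / 2 * P t" "\<lambda>t. hl / 2 * e t"])
      fix t assume "max T T' \<le> t"
      then have t: "t0 \<le> t" "T' \<le> t" using T by auto
      show "DERIV (\<lambda>t. - R t) t :> - g t" by (intro DERIV_minus DR t)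
      show "DERIV (\<lambda>t. hl / 2 * P t) t :> hl / 2 * e t" by (intro DERIV_cmult DP t)
      show "0 \<le> hl / 2 * e t" using \<open>\<not> hl \<le> 0\<close> e_nonneg[OF t(1)] by simp
      show "- g t \<le> - (hl / 2 * e t)"
        using mult_left_mono[OF less_imp_le[OF T'[OF t(2)]] e_nonneg[OF t(1)]]
        by (simp add: g_def mult.commute)
    qed (rule filterlim_tendsto_pos_mult_at_top[OF tendsto_const _ P(2)],
        use \<open>\<not> hl \<le> 0\<close> in simp)
    then obtain t where "- R t \<le> - (R T + V T / m) - 1"
      using eventually_happens'[OF trivial_limit_at_top_linorder] by blast
    then show False using R_bound[of t] by simp
  qed
  moreover have "0 \<le> hl"
    using tendsto_lowerbound[OF h_lim, of 0] h_nonneg by simp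
  ultimately show "(x \<longlongrightarrow> p) at_top"
    using h_lim by (intro tendsto_if_h_tendsto_0) simp
qed

end

theorem theorem1p4:
  fixes \<Phi> U :: "'a::{real_inner, complete_space} \<Rightarrow> real"
    and grad\<Phi> gradU :: "'a \<Rightarrow> 'a"
    and \<epsilon> \<gamma> :: "real \<Rightarrow> real"
    and t0 \<alpha> \<theta> :: real
    and x x' x'' :: "real \<Rightarrow> 'a"
  assumes "t0 > 0"
    and "convex_on UNIV \<Phi>" and "C1_with_gradient \<Phi> grad\<Phi>" and "bdd_below (range \<Phi>)"
    and "convex_on UNIV U" and "C1_with_gradient U gradU" and "bdd_below (range U)"
    and "argmin_set \<Phi> \<noteq> {}"
    and "lipschitz_on_bounded_sets grad\<Phi>" and "lipschitz_on_bounded_sets gradU"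
    and "\<And>t. t \<ge> t0 \<Longrightarrow> \<epsilon> t > 0"
    and "absolutely_continuous_fun_on {t0..} \<epsilon>"
    and "antimono_on {t0..} \<epsilon>"
    and "(\<epsilon> \<longlongrightarrow> 0) at_top"
    and "strongly_convex U"
    and "0 \<le> \<theta>" and "\<theta> \<le> 1"
    and "\<theta> < 1 \<Longrightarrow> \<alpha> > 0" and "\<theta> = 1 \<Longrightarrow> \<alpha> > 3"
    and "\<And>t. t \<ge> t0 \<Longrightarrow> \<gamma> t = \<alpha> / t powr \<theta>"
    and "(\<integral>\<^sup>+t\<in>{t0..}. ennreal (t powr \<theta> * \<epsilon> t) \<partial>lborel) = \<infinity>"
    and "C2_curve t0 x x' x''"
    and "\<And>t. t \<ge> t0 \<Longrightarrow>
           x'' t + \<gamma> t *\<^sub>R x' t + grad\<Phi> (x t) + \<epsilon> t *\<^sub>R gradU (x t) = 0"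
  shows "(\<exists>p. unique_minimizer_on (argmin_set \<Phi>) U p \<and>
            ((\<lambda>t. norm (x' t)) \<in> o[at_top](\<lambda>t. 1 / t powr \<theta>) \<and>
             set_integrable lborel {t0..} (\<lambda>t. t powr \<theta> * (norm (x' t))\<^sup>2)
             \<longrightarrow> (x \<longlongrightarrow> p) at_top))
       \<and> (\<exists>p. unique_minimizer_on UNIV U p \<and>
            (p \<in> argmin_set \<Phi>
             \<longrightarrow> (x \<longlongrightarrow> p) at_top \<and>
                energy \<Phi> U \<epsilon> x x' \<in> o[at_top](\<lambda>t. 1 / t powr (1 + \<theta>)) \<and>
                set_integrable lborel {t0..} (\<lambda>t. t powr \<theta> * energy \<Phi> U \<epsilon> x x' t)))"
proof -
  obtain m where m: "m > 0" "convex_on UNIV (\<lambda>y. U y - m / 2 * (norm y)\<^sup>2)"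
    using assms(15) unfolding strongly_convex_def by blast
  have \<epsilon>_cont: "continuous_on {t0..} \<epsilon>"
    using assms(12) by (rule absolutely_continuous_fun_on_imp_continuous_on) simp
  interpret inertial_trajectory \<Phi> U grad\<Phi> gradU \<epsilon> t0 \<alpha> \<theta> m x x' x''
    using assms m \<epsilon>_cont by unfold_locales auto
  \<comment> \<open>As a sublevel set of \<open>\<Phi>\<close>, the set of minimizers is closed and
    convex.\<close>
  have argmin: "argmin_set \<Phi> = {y. \<Phi> y \<le> \<Phi>min}"
    using \<Phi>min_le by (auto simp: argmin_set_def intro: antisym)
  obtain p where p: "unique_minimizer_on (argmin_set \<Phi>) U p"
    using strongly_convex_unique_minimizer[OF m continuous_potentials(2) U_bdd]
      sublevel_closed_convex[OF \<Phi>_convex continuous_potentials(1)] assms(8) unfolding argmin by metis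
  then have "is_arg_min U (\<lambda>z. z \<in> argmin_set \<Phi>) p"
    by (simp add: unique_minimizer_on_def)
  then have p': "\<Phi> p = \<Phi>min" "\<And>y. \<Phi> y = \<Phi>min \<Longrightarrow> U p \<le> U y"
    by (auto simp: is_arg_min_linorder argmin_set_def)
  obtain q where q: "unique_minimizer_on UNIV U q"
    using strongly_convex_unique_minimizer[OF m continuous_potentials(2) U_bdd] by blast
  then have "is_arg_min U (\<lambda>z. z \<in> UNIV) q"
    by (simp add: unique_minimizer_on_def)
  then have q_min: "U q = Umin"
    by (intro antisym cINF_greatest Umin_le) (auto simp: is_arg_min_linorder)
  have smallo: "f \<in> o[at_top](\<lambda>t. 1 / t powr r) \<longleftrightarrow> ((\<lambda>t. t powr r * f t) \<longlongrightarrow> 0) at_top"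
    for f :: "real \<Rightarrow> real" and r
  proof -
    \<comment> \<open>At t = 0 the comparison function is 0, so nonvanishing is claimed only
      eventually.\<close>
    have "\<forall>\<^sub>F t in at_top. (1 :: real) / t powr r \<noteq> 0"
      using eventually_gt_at_top[of 0] by eventually_elim simp
    moreover have "(\<lambda>t. f t / (1 / t powr r)) = (\<lambda>t. t powr r * f t)"
      by (simp add: mult.commute)
    ultimately show ?thesis
      using smalloI_tendsto[of f "\<lambda>t. 1 / t powr r" at_top]
        smalloD_tendsto[of f at_top "\<lambda>t. 1 / t powr r"] by auto
  qed
  have "(x \<longlongrightarrow> p) at_top"
    if "(\<lambda>t. norm (x' t)) \<in> o[at_top](\<lambda>t. 1 / t powr \<theta>)"
      "set_integrable lborel {t0..} (\<lambda>t. t powr \<theta> * (norm (x' t))\<^sup>2)"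
    using convergence_of_slow_trajectory[OF p'] that by (simp add: smallo)
  moreover have "(x \<longlongrightarrow> q) at_top \<and> W \<in> o[at_top](\<lambda>t. 1 / t powr (1 + \<theta>)) \<and>
      set_integrable lborel {t0..} (\<lambda>t. t powr \<theta> * W t)" if "q \<in> argmin_set \<Phi>"
    using convergence_to_global_minimizer[OF _ q_min] that by (simp add: smallo argmin_set_def)
  ultimately show ?thesis using p q by blast
qed

end
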